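(* Let $\mathfrak{g}$ be a complex simple Lie algebra and let $\tau=\mathfrak{m}+\mathfrak{r}_0$ be a standard subalgebra of $\mathfrak{g}$ with nilpotent radical, where $\mathfrak{m}$ is the nilpotent standard subalgebra associated to a set $\mathfrak{R}$ of pairwise noncomparable positive roots and $\mathfrak{r}_0$ (the semisimple part of $\tau$) is an ideal of $\mathfrak{r}_1$ contained in $\mathfrak{r}_2$, with associated subset $\Psi\subset\Pi$. Let $V_\tau=[\tau,\mathfrak{g}]$ and $V_{\mathfrak{m}}=[\mathfrak{m},\mathfrak{g}]$. Then: 1. $V_\tau=V_{\mathfrak{m}}$ if $P_\Psi^-=\{0\}$. 2. $V_\tau=\mathfrak{g}$ if $P_\Psi^-\neq\{0\}$.
   Context: $\mathfrak{g}$ is a finite dimensional complex simple Lie algebra, $\mathfrak{h}$ a Cartan subalgebra, $\Delta$ the root system, $\Pi$ a basis of simple roots, $\Delta_+$ the positive roots, $\mathfrak{g}_\alpha$ the root spaces, $e_\alpha$ a nonzero element of $\mathfrak{g}_\alpha$. Partial order on $\mathfrak{h}^*$: $\omega_1\leqslant\omega_2$ if $\omega_2-\omega_1$ is a linear combination of simple roots with non-negative coefficients. A subalgebra is standard if its normalizer is parabolic. For a set $\mathfrak{R}\subset\Delta_+$ of pairwise noncomparable roots, $\mathfrak{R}_1=\{\beta\in\Delta_+:\omega\leqslant\beta\text{ for some }\omega\in\mathfrak{R}\}$, and the nilpotent standard subalgebra associated to $\mathfrak{R}$ is $\mathfrak{m}=\sum_{\beta\in\mathfrak{R}_1}\mathfrak{g}_\beta$;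 $\mathfrak{R}_2=\{\alpha\in\Delta_+:\alpha+\beta\in\Delta\text{ for some }\beta\in\mathfrak{R}_1\}$. For a positive root $\beta$, $S^\beta=\{\gamma\in\Pi:\beta=\gamma\text{ or }\beta-\gamma\in\Delta\}$. Set $S_1=\mathfrak{R}\cap\Pi$ and $S_2=\bigcup_{\omega\in\mathfrak{R}}S^\omega$. For $B\subset\Pi$, $\langle B\rangle$ is the set of roots that are linear combinations of elements of $B$. Set $\Omega_1=\langle\Pi\setminus S_1\rangle$, $\Delta_1=\langle\Pi\setminus S_2\rangle$, $\mathfrak{r}_1=\mathfrak{h}+\sum_{\alpha\in\Omega_1}\mathfrak{g}_\alpha$, $\mathfrak{r}_2=\mathfrak{h}+\sum_{\alpha\in\Delta_1}\mathfrak{g}_\alpha$. Here $\Psi$ is a common connected subsystem (connected component of the Dynkin diagrams) of $\Pi\setminus S_1$ and $\Pi\setminus S_2$ such that $\mathfrak{r}_0=\sum_{\alpha\in\langle\Psi\rangle}\mathfrak{g}_\alpha+\sum_{\alpha\in\langle\Psi\rangle}\mathbb{C}[e_\alpha,e_{-\alpha}]$. Finally $\mathfrak{n}_2^-=\sum_{\beta\in\Delta_+\setminus\mathfrak{R}_2}\mathfrak{g}_{-\beta}$ and $P_\Psi^-=\sum_{\alpha\in\langle\Psi\rangle}[\mathfrak{g}_\alpha,\mathfrak{n}_2^-]$. For subspaces $U,W$, $[U,W]$ denotes the linear span of all brackets. *)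

theory Defs
  imports Complex_Main "HOL-Library.Function_Algebras"
begin

section \<open>Complex Lie algebras\<close>

class complex_lie_algebra = ab_group_add +
  fixes scaleC :: "complex \<Rightarrow> 'a \<Rightarrow> 'a" (infixr "*\<^sub>C" 75)
    and lie :: "'a \<Rightarrow> 'a \<Rightarrow> 'a"
  assumes scaleC_add_right: "c *\<^sub>C (x + y) = c *\<^sub>C x + c *\<^sub>C y"
    and scaleC_add_left: "(c + d) *\<^sub>C x = c *\<^sub>C x + d *\<^sub>C x"
    and scaleC_scaleC: "c *\<^sub>C d *\<^sub>C x = (c * d) *\<^sub>C x"
    and scaleC_one: "1 *\<^sub>C x = x"
    and lie_add_left: "lie (x + y) z = lie x z + lie y z"
    and lie_add_right: "lie x (y + z) = lie x y + lie x z"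
    and lie_scaleC_left: "lie (c *\<^sub>C x) y = c *\<^sub>C lie x y"
    and lie_scaleC_right: "lie x (c *\<^sub>C y) = c *\<^sub>C lie x y"
    and lie_self: "lie x x = 0"
    and jacobi: "lie x (lie y z) + lie y (lie z x) + lie z (lie x y) = 0"

global_interpretation complex_vec: vector_space "scaleC :: complex \<Rightarrow> 'a \<Rightarrow> 'a::complex_lie_algebra"
  by unfold_locales
    (simp_all add: scaleC_add_right scaleC_add_left scaleC_scaleC scaleC_one)

definition bracket_span :: "'a::complex_lie_algebra set \<Rightarrow> 'a set \<Rightarrow> 'a set" where
  "bracket_span U W = complex_vec.span {lie u w | u w. u \<in> U \<and> w \<in> W}"

definition lie_subalgebra :: "'a::complex_lie_algebra set \<Rightarrow> bool" where
  "lie_subalgebra S \<longleftrightarrow> complex_vec.subspace S \<and> (\<forall>x\<in>S. \<forall>y\<in>S. lie x y \<in> S)"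

definition lie_ideal :: "'a::complex_lie_algebra set \<Rightarrow> 'a set \<Rightarrow> bool" where
  "lie_ideal I S \<longleftrightarrow>
     complex_vec.subspace I \<and> I \<subseteq> S \<and> (\<forall>x\<in>S. \<forall>y\<in>I. lie x y \<in> I)"

definition lie_abelian :: "'a::complex_lie_algebra set \<Rightarrow> bool" where
  "lie_abelian S \<longleftrightarrow> (\<forall>x\<in>S. \<forall>y\<in>S. lie x y = 0)"

definition lie_simple :: "'a::complex_lie_algebra set \<Rightarrow> bool" where
  "lie_simple S \<longleftrightarrow> lie_subalgebra S \<and> \<not> lie_abelian S \<and>
     (\<forall>I. lie_ideal I S \<longrightarrow> I = {0} \<or> I = S)"

definition lie_solvable :: "'a::complex_lie_algebra set \<Rightarrow> bool" where
  "lie_solvable S \<longleftrightarrow> (\<exists>n. ((\<lambda>T. bracket_span T T) ^^ n) S = {0})"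

definition lie_nilpotent :: "'a::complex_lie_algebra set \<Rightarrow> bool" where
  "lie_nilpotent S \<longleftrightarrow> (\<exists>n. ((\<lambda>T. bracket_span S T) ^^ n) S = {0})"

text \<open>The sum of all solvable ideals; in finite dimension it is the largest solvable ideal.\<close>

definition lie_radical :: "'a::complex_lie_algebra set \<Rightarrow> 'a set" where
  "lie_radical S = complex_vec.span (\<Union>{I. lie_ideal I S \<and> lie_solvable I})"

definition lie_semisimple :: "'a::complex_lie_algebra set \<Rightarrow> bool" where
  "lie_semisimple S \<longleftrightarrow> lie_subalgebra S \<and> lie_radical S = {0}"

definition levi_factor :: "'a::complex_lie_algebra set \<Rightarrow> 'a set \<Rightarrow> bool" where
  "levi_factor L S \<longleftrightarrow> L \<subseteq> S \<and> lie_semisimple L \<and>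
     complex_vec.span (lie_radical S \<union> L) = S \<and> lie_radical S \<inter> L = {0}"

definition lie_normalizer :: "'a::complex_lie_algebra set \<Rightarrow> 'a set" where
  "lie_normalizer S = {x. \<forall>y\<in>S. lie x y \<in> S}"

definition borel_subalgebra :: "'a::complex_lie_algebra set \<Rightarrow> bool" where
  "borel_subalgebra B \<longleftrightarrow> lie_subalgebra B \<and> lie_solvable B \<and>
     (\<forall>S. lie_subalgebra S \<and> lie_solvable S \<and> B \<subseteq> S \<longrightarrow> S = B)"

definition parabolic_subalgebra :: "'a::complex_lie_algebra set \<Rightarrow> bool" where
  "parabolic_subalgebra P \<longleftrightarrow> lie_subalgebra P \<and> (\<exists>B. borel_subalgebra B \<and> B \<subseteq> P)"

definition standard_subalgebra :: "'a::complex_lie_algebra set \<Rightarrow> bool" where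
  "standard_subalgebra S \<longleftrightarrow> lie_subalgebra S \<and> parabolic_subalgebra (lie_normalizer S)"


section \<open>Cartan subalgebras, roots and simple roots\<close>

text \<open>Over the complex numbers an endomorphism is semisimple iff it is diagonalizable.\<close>

definition ad_semisimple :: "'a::complex_lie_algebra \<Rightarrow> bool" where
  "ad_semisimple H \<longleftrightarrow> complex_vec.span {x. \<exists>c. lie H x = c *\<^sub>C x} = UNIV"

text \<open>
  The definition of a Cartan subalgebra of a complex semisimple Lie algebra (as in Helgason):
  a maximal abelian subalgebra all of whose elements are ad-semisimple.
\<close>

definition cartan_subalgebra :: "'a::complex_lie_algebra set \<Rightarrow> bool" where
  "cartan_subalgebra h \<longleftrightarrow> lie_subalgebra h \<and> lie_abelian h \<and>
     (\<forall>S. lie_subalgebra S \<and> lie_abelian S \<and> h \<subseteq> S \<longrightarrow> S = h) \<and>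
     (\<forall>H\<in>h. ad_semisimple H)"

text \<open>
  A linear functional on \<open>h\<close> is represented by the function on the whole algebra that
  extends it by \<open>0\<close> outside \<open>h\<close>, so that equality and the
  pointwise operations are those of the dual space.
\<close>

definition dual_space :: "'a::complex_lie_algebra set \<Rightarrow> ('a \<Rightarrow> complex) set" where
  "dual_space h = {f. (\<forall>x\<in>h. \<forall>y\<in>h. f (x + y) = f x + f y) \<and>
     (\<forall>c. \<forall>x\<in>h. f (c *\<^sub>C x) = c * f x) \<and> (\<forall>x. x \<notin> h \<longrightarrow> f x = 0)}"

definition root_space :: "'a::complex_lie_algebra set \<Rightarrow> ('a \<Rightarrow> complex) \<Rightarrow> 'a set" where
  "root_space h \<alpha> = {x. \<forall>H\<in>h. lie H x = \<alpha> H *\<^sub>C x}"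

definition roots :: "'a::complex_lie_algebra set \<Rightarrow> ('a \<Rightarrow> complex) set" where
  "roots h = {\<alpha> \<in> dual_space h. \<alpha> \<noteq> 0 \<and> root_space h \<alpha> \<noteq> {0}}"

definition lincomb :: "(('a \<Rightarrow> complex) \<Rightarrow> real) \<Rightarrow> ('a \<Rightarrow> complex) set \<Rightarrow> 'a \<Rightarrow> complex" where
  "lincomb c B = (\<lambda>H. \<Sum>\<gamma>\<in>B. of_real (c \<gamma>) * \<gamma> H)"

definition root_basis :: "'a::complex_lie_algebra set \<Rightarrow> ('a \<Rightarrow> complex) set \<Rightarrow> bool" where
  "root_basis h Pi \<longleftrightarrow> Pi \<subseteq> roots h \<and> finite Pi \<and>
     (\<forall>c. lincomb c Pi = 0 \<longrightarrow> (\<forall>\<gamma>\<in>Pi. c \<gamma> = 0)) \<and>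
     (\<forall>\<beta>\<in>roots h. \<exists>c. \<beta> = lincomb c Pi \<and> (\<forall>\<gamma>\<in>Pi. c \<gamma> \<in> \<int>) \<and>
        ((\<forall>\<gamma>\<in>Pi. c \<gamma> \<ge> 0) \<or> (\<forall>\<gamma>\<in>Pi. c \<gamma> \<le> 0)))"

definition weight_le ::
  "('a \<Rightarrow> complex) set \<Rightarrow> ('a \<Rightarrow> complex) \<Rightarrow> ('a \<Rightarrow> complex) \<Rightarrow> bool" where
  "weight_le Pi \<omega>\<^sub>1 \<omega>\<^sub>2 \<longleftrightarrow> (\<exists>c. (\<forall>\<gamma>\<in>Pi. c \<gamma> \<ge> 0) \<and> \<omega>\<^sub>2 - \<omega>\<^sub>1 = lincomb c Pi)"

definition pos_roots ::
  "'a::complex_lie_algebra set \<Rightarrow> ('a \<Rightarrow> complex) set \<Rightarrow> ('a \<Rightarrow> complex) set" where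
  "pos_roots h Pi = {\<beta> \<in> roots h. weight_le Pi 0 \<beta>}"

definition generated_roots ::
  "'a::complex_lie_algebra set \<Rightarrow> ('a \<Rightarrow> complex) set \<Rightarrow> ('a \<Rightarrow> complex) set" where
  "generated_roots h B = {\<beta> \<in> roots h. \<exists>c. \<beta> = lincomb c B}"


section \<open>Dynkin diagrams\<close>

definition coroot :: "'a::complex_lie_algebra set \<Rightarrow> ('a \<Rightarrow> complex) \<Rightarrow> 'a" where
  "coroot h \<alpha> =
     (THE H. H \<in> bracket_span (root_space h \<alpha>) (root_space h (- \<alpha>)) \<and> \<alpha> H = 2)"

text \<open>Two simple roots are joined iff their number of edges, the product of the two
  Cartan integers, is nonzero.\<close>

definition dynkin_adj ::
  "'a::complex_lie_algebra set \<Rightarrow> ('a \<Rightarrow> complex) set \<Rightarrow> (('a \<Rightarrow> complex) \<times> ('a \<Rightarrow> complex)) set" where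
  "dynkin_adj h B = {(\<gamma>, \<delta>). \<gamma> \<in> B \<and> \<delta> \<in> B \<and> \<gamma> \<noteq> \<delta> \<and>
     \<gamma> (coroot h \<delta>) * \<delta> (coroot h \<gamma>) \<noteq> 0}"

definition dynkin_components ::
  "'a::complex_lie_algebra set \<Rightarrow> ('a \<Rightarrow> complex) set \<Rightarrow> ('a \<Rightarrow> complex) set set" where
  "dynkin_components h B = (\<lambda>\<gamma>. (dynkin_adj h B)\<^sup>* `` {\<gamma>}) ` B"


section \<open>Data attached to a set of pairwise noncomparable positive roots\<close>

definition R1 where
  "R1 h Pi R = {\<beta> \<in> pos_roots h Pi. \<exists>\<omega>\<in>R. weight_le Pi \<omega> \<beta>}"

definition R2 where
  "R2 h Pi R = {\<alpha> \<in> pos_roots h Pi. \<exists>\<beta>\<in>R1 h Pi R. \<alpha> + \<beta> \<in> roots h}"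

definition nilp_standard where
  "nilp_standard h Pi R = complex_vec.span (\<Union>\<beta>\<in>R1 h Pi R. root_space h \<beta>)"

definition S_root where
  "S_root h Pi \<beta> = {\<gamma> \<in> Pi. \<beta> = \<gamma> \<or> \<beta> - \<gamma> \<in> roots h}"

definition S1 :: "('a \<Rightarrow> complex) set \<Rightarrow> ('a \<Rightarrow> complex) set \<Rightarrow> ('a \<Rightarrow> complex) set" where
  "S1 Pi R = R \<inter> Pi"

definition S2 where
  "S2 h Pi R = (\<Union>\<omega>\<in>R. S_root h Pi \<omega>)"

definition reductive_part where
  "reductive_part h B = complex_vec.span (h \<union> (\<Union>\<alpha>\<in>generated_roots h B. root_space h \<alpha>))"

definition r1 where
  "r1 h Pi R = reductive_part h (Pi - S1 Pi R)"

definition r2 where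
  "r2 h Pi R = reductive_part h (Pi - S2 h Pi R)"

definition r_Psi where
  "r_Psi h e Psi = complex_vec.span
     ((\<Union>\<alpha>\<in>generated_roots h Psi. root_space h \<alpha>) \<union>
      {lie (e \<alpha>) (e (- \<alpha>)) | \<alpha>. \<alpha> \<in> generated_roots h Psi})"

definition n2_minus where
  "n2_minus h Pi R =
     complex_vec.span (\<Union>\<beta>\<in>pos_roots h Pi - R2 h Pi R. root_space h (- \<beta>))"

definition P_minus where
  "P_minus h Pi R Psi = complex_vec.span
     (\<Union>\<alpha>\<in>generated_roots h Psi. bracket_span (root_space h \<alpha>) (n2_minus h Pi R))"

end

theory Submission
  imports Defs
begin

text \<open>
  The idea is to grade \<open>\<gg>\<close> by the total coefficient (the level) of a root along the simple roots in
  \<open>S\<^sub>1 = R \<inter> Pi\<close>. The part of level zero is exactly \<open>r\<^sub>1\<close>, and the part \<open>n\<close> of positive level lies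
  in \<open>m\<close>, because a root of positive level dominates an element of \<open>R \<inter> Pi\<close>. Let \<open>L\<close> be the part of
  lowest level.

  Simplicity of \<open>\<gg>\<close> enters through one observation (\<open>levi_stable_sum_nilrad\<close>): a nonzero
  subspace \<open>T\<close> of \<open>L\<close> that is stable under \<open>r\<^sub>1\<close> is killed by all negative levels, so the ideal it
  generates is reached by brackets with \<open>r\<^sub>1\<close> and \<open>n\<close> alone, whence \<open>T + [n, \<gg>] = \<gg>\<close>. It follows
  that \<open>L\<close> is irreducible under \<open>r\<^sub>1\<close> and that \<open>[n, \<gg>]\<close> is the sum of all levels above the lowest one.

  Now \<open>[n, \<gg>] \<subseteq> [m, \<gg>] \<subseteq> [\<tau>, \<gg>]\<close>, so all that \<open>r\<^sub>0\<close> can add to \<open>[m, \<gg>]\<close> comes from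
  \<open>[r\<^sub>0, L]\<close>. As \<open>r\<^sub>0\<close> is an ideal of \<open>r\<^sub>1\<close>, this is an \<open>r\<^sub>1\<close>-stable subspace of \<open>L\<close>, hence zero
  or all of \<open>L\<close>; the first case gives \<open>[\<tau>, \<gg>] = [m, \<gg>]\<close> and the second \<open>[\<tau>, \<gg>] = \<gg>\<close>
  (\<open>ideal_bracket_dichotomy\<close>).

  It remains to see that \<open>[r\<^sub>0, L] = 0\<close> exactly when \<open>P\<^sup>- = 0\<close>, that is, when \<open>r\<^sub>0\<close>
  kills \<open>n\<^sub>2\<^sup>-\<close>. On the one hand \<open>n\<^sub>2\<^sup>- \<subseteq> L\<close>: if \<open>\<beta>\<close> is not
  of top level, then \<open>\<gg>\<^bsub>-\<beta>\<^esub> \<subseteq> [n, \<gg>]\<close> forces \<open>\<beta> + \<delta>\<close> to be a root for some \<open>\<delta>\<close> of positive level,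
  and \<open>\<beta> \<in> R\<^sub>2\<close>. On the other hand \<open>n\<^sub>2\<^sup>-\<close> meets \<open>L\<close> nontrivially, in the root space of \<open>-\<beta>\<close> for \<open>\<beta>\<close> of
  greatest height among the positive roots of top level; if \<open>r\<^sub>0\<close> kills one nonzero vector of \<open>L\<close>, it kills
  \<open>L\<close> by irreducibility, since the invariants of an ideal of \<open>r\<^sub>1\<close> are \<open>r\<^sub>1\<close>-stable.

  The structure theory used along the way is the root space decomposition (by simultaneous
  diagonalization) and the symmetry of the root system under negation. The latter is obtained from
  the Killing form, computed as a trace in a fixed basis of weight vectors.
\<close>

section \<open>Brackets, eigenspaces and simultaneous diagonalization\<close>

lemma lie_zero_left [simp]: "lie 0 x = (0 :: 'a::complex_lie_algebra)"
  using lie_add_left[of 0 0 x] by simp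

lemma lie_zero_right [simp]: "lie x 0 = (0 :: 'a::complex_lie_algebra)"
  using lie_add_right[of x 0 0] by simp

lemma lie_anticomm: "lie y x = - lie x (y :: 'a::complex_lie_algebra)"
proof -
  have "lie (x + y) (x + y) = lie x x + lie x y + (lie y x + lie y y)"
    by (simp only: lie_add_left lie_add_right add_ac)
  hence "lie x y + lie y x = 0" by (simp only: lie_self add_0 add_0_right)
  thus ?thesis by (metis add_eq_0_iff)
qed

lemma lie_minus_right [simp]: "lie x (- y) = - lie x (y :: 'a::complex_lie_algebra)"
  using lie_add_right[of x y "- y"] by (simp add: add_eq_0_iff)

lemma lie_minus_left [simp]: "lie (- x) y = - lie x (y :: 'a::complex_lie_algebra)"
  using lie_add_left[of x "- x" y] by (simp add: add_eq_0_iff)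

lemma lie_diff_right: "lie x (y - z) = lie x y - lie x (z :: 'a::complex_lie_algebra)"
  by (simp only: diff_conv_add_uminus lie_add_right lie_minus_right)

lemma lie_sum_right: "lie x (sum f A) = (\<Sum>a\<in>A. lie x (f a :: 'a::complex_lie_algebra))"
  by (induction A rule: infinite_finite_induct) (auto simp: lie_add_right)

lemma lie_leibniz: "lie x (lie y z) = lie (lie x y) z + lie y (lie x (z :: 'a::complex_lie_algebra))"
proof -
  have "lie x (lie y z) = - (lie y (lie z x) + lie z (lie x y))"
    using jacobi[of x y z] by (simp only: add.assoc eq_neg_iff_add_eq_0)
  also have "\<dots> = - lie y (lie z x) - lie z (lie x y)" by simp
  also have "lie z x = - lie x z" by (rule lie_anticomm)
  also have "lie z (lie x y) = - lie (lie x y) z" by (rule lie_anticomm)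
  finally show ?thesis by simp
qed

lemma bracket_span_mono: "U \<subseteq> U' \<Longrightarrow> W \<subseteq> W' \<Longrightarrow> bracket_span U W \<subseteq> bracket_span U' W'"
  unfolding bracket_span_def by (intro complex_vec.span_mono) blast

lemma lie_in_bracket_span: "u \<in> U \<Longrightarrow> w \<in> W \<Longrightarrow> lie u w \<in> bracket_span U W"
  unfolding bracket_span_def by (rule complex_vec.span_base) blast

lemma subspace_bracket_span: "complex_vec.subspace (bracket_span U W)"
  unfolding bracket_span_def by (rule complex_vec.subspace_span)

lemma bracket_span_subset:
  assumes "complex_vec.subspace S" "\<And>u w. u \<in> U \<Longrightarrow> w \<in> W \<Longrightarrow> lie u w \<in> S"
  shows "bracket_span U W \<subseteq> S"
  unfolding bracket_span_def using assms by (intro complex_vec.span_minimal) auto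

lemma subspace_lie_vimage_right:
  assumes "complex_vec.subspace S"
  shows "complex_vec.subspace {y. lie x y \<in> S}"
  using assms by (auto simp: complex_vec.subspace_def lie_add_right lie_scaleC_right)

lemma subspace_lie_vimage_left:
  assumes "complex_vec.subspace S"
  shows "complex_vec.subspace {x. lie x y \<in> S}"
  using assms by (auto simp: complex_vec.subspace_def lie_add_left lie_scaleC_left)

lemma lie_span_span:
  assumes "complex_vec.subspace S" "\<And>u w. u \<in> U \<Longrightarrow> w \<in> W \<Longrightarrow> lie u w \<in> S"
    and "x \<in> complex_vec.span U" "y \<in> complex_vec.span W"
  shows "lie x y \<in> S"
proof -
  have "complex_vec.span W \<subseteq> {y. lie u y \<in> S}" if "u \<in> U" for u
    by (rule complex_vec.span_minimal) (use assms that subspace_lie_vimage_right in auto)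
  hence "U \<subseteq> {x. lie x y \<in> S}" using assms(4) by blast
  hence "complex_vec.span U \<subseteq> {x. lie x y \<in> S}"
    by (rule complex_vec.span_minimal) (use assms subspace_lie_vimage_left in auto)
  thus ?thesis using assms(3) by blast
qed

lemma bracket_span_span: "bracket_span (complex_vec.span U) W = bracket_span U W"
proof
  show "bracket_span (complex_vec.span U) W \<subseteq> bracket_span U W"
    by (rule bracket_span_subset[OF subspace_bracket_span],
        rule lie_span_span[OF subspace_bracket_span, of U W])
       (auto intro: lie_in_bracket_span complex_vec.span_base)
qed (intro bracket_span_mono complex_vec.span_superset order_refl)


lemma subspace_root_space: "complex_vec.subspace (root_space K \<nu>)"
  by (auto simp: complex_vec.subspace_def root_space_def lie_add_right scaleC_add_right
      lie_scaleC_right scaleC_scaleC mult.commute)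

lemma lie_root_space:
  assumes "x \<in> root_space K \<alpha>" "y \<in> root_space K \<beta>"
  shows "lie x y \<in> root_space K (\<alpha> + \<beta>)"
  unfolding root_space_def
proof (intro CollectI ballI)
  fix H assume "H \<in> K"
  with assms have "lie H x = \<alpha> H *\<^sub>C x" "lie H y = \<beta> H *\<^sub>C y" by (auto simp: root_space_def)
  thus "lie H (lie x y) = (\<alpha> + \<beta>) H *\<^sub>C lie x y"
    by (subst lie_leibniz) (simp add: lie_scaleC_left lie_scaleC_right scaleC_add_left)
qed

lemma root_space_eq_on:
  assumes "x \<in> root_space K \<alpha>" "x \<in> root_space K \<beta>" "x \<noteq> 0" "H \<in> K"
  shows "\<alpha> H = \<beta> H"
  using assms by (auto simp: root_space_def)

text \<open>
  Comparing coefficients in \<open>lie H x = \<mu> H *\<^sub>C x\<close> shows that only basis vectors of the same weight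
  occur in a weight vector. This replaces the linear independence of eigenspaces throughout.
\<close>

lemma representation_eigen_component:
  assumes B: "complex_vec.independent B" "complex_vec.span B = (UNIV :: 'a::complex_lie_algebra set)"
      "finite B" "\<And>b. b \<in> B \<Longrightarrow> \<exists>\<nu>. b \<in> root_space K \<nu>"
    and x: "x \<in> root_space K \<mu>" "complex_vec.representation B x b \<noteq> 0"
  shows "b \<in> root_space K \<mu>"
  unfolding root_space_def
proof (intro CollectI ballI)
  fix H assume H: "H \<in> K"
  let ?r = "complex_vec.representation B x"
  obtain w where w: "b \<in> root_space K (w b)" if "b \<in> B" for b using B(4) by metis
  have bB: "b \<in> B" using x(2) by (rule complex_vec.representation_ne_zero)
  have "(\<Sum>c\<in>B. ?r c *\<^sub>C c) = x"
    using complex_vec.sum_representation_eq[of B x B] B by simp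
  hence "lie H x = (\<Sum>c\<in>B. lie H (?r c *\<^sub>C c))" by (simp only: flip: lie_sum_right)
  also have "\<dots> = (\<Sum>c\<in>B. (?r c * w c H) *\<^sub>C c)"
    using w H by (intro sum.cong refl) (simp add: root_space_def lie_scaleC_right scaleC_scaleC)
  finally have "complex_vec.representation B (lie H x) b
      = (\<Sum>c\<in>B. (?r c * w c H) * complex_vec.representation B c b)"
    using B by (simp add: complex_vec.representation_sum complex_vec.representation_scale)
  also have "\<dots> = (\<Sum>c\<in>B. if c = b then ?r c * w c H else 0)"
    using B by (intro sum.cong refl) (auto simp: complex_vec.representation_basis)
  also have "\<dots> = ?r b * w b H" using bB B by simp
  finally have "complex_vec.representation B (lie H x) b = ?r b * w b H" .
  moreover have "lie H x = \<mu> H *\<^sub>C x" using x H by (simp add: root_space_def)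
  ultimately have "\<mu> H * ?r b = ?r b * w b H"
    using B by (simp add: complex_vec.representation_scale)
  hence "w b H = \<mu> H" using x(2) by simp
  thus "lie H b = \<mu> H *\<^sub>C b" using w[OF bB] H by (simp add: root_space_def)
qed

lemma span_UNIV_mono: "A \<subseteq> B \<Longrightarrow> complex_vec.span A = UNIV \<Longrightarrow> complex_vec.span B = UNIV"
  using complex_vec.span_mono by blast

lemma basis_subset:
  assumes fin: "\<exists>F. finite F \<and> complex_vec.span F = (UNIV :: 'a::complex_lie_algebra set)"
    and X: "complex_vec.span X = (UNIV :: 'a set)"
  obtains B where "B \<subseteq> X" "finite B" "complex_vec.independent B" "complex_vec.span B = (UNIV :: 'a set)"
proof -
  obtain B where B: "B \<subseteq> X" "complex_vec.independent B" "X \<subseteq> complex_vec.span B"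
    using complex_vec.maximal_independent_subset[of X] by metis
  have "complex_vec.span B = UNIV"
    using X B(3) by (metis UNIV_eq_I complex_vec.span_minimal complex_vec.subspace_span top.extremum_uniqueI)
  moreover have "finite B"
    using fin B(2) complex_vec.independent_span_bound by (metis subset_UNIV)
  ultimately show ?thesis using B that by blast
qed

text \<open>
  Induction on the family: the projections onto the eigenspaces of a new element \<open>H0\<close> commute with the
  old ones, so they split a joint eigenvector of \<open>K\<close> into joint eigenvectors of \<open>insert H0 K\<close>.
\<close>

lemma finite_simultaneous_diagonalization:
  assumes fin: "\<exists>F. finite F \<and> complex_vec.span F = (UNIV :: 'a::complex_lie_algebra set)"
    and "finite K" "\<And>H. H \<in> K \<Longrightarrow> ad_semisimple H" "lie_abelian K"
  shows "complex_vec.span (\<Union>\<nu>. root_space K \<nu>) = (UNIV :: 'a set)"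
  using assms(2-)
proof (induction K rule: finite_induct)
  case empty
  have "(\<Union>\<nu>. root_space {} \<nu>) = (UNIV :: 'a set)" by (auto simp: root_space_def)
  thus ?case by simp
next
  case (insert H0 K)
  have "{x. \<exists>c. lie H0 x = c *\<^sub>C x} \<subseteq> (\<Union>\<nu>. root_space {H0} \<nu>)"
  proof
    fix x assume "x \<in> {x. \<exists>c. lie H0 x = c *\<^sub>C x}"
    then obtain c where "lie H0 x = c *\<^sub>C x" by blast
    hence "x \<in> root_space {H0} (\<lambda>_. c)" by (simp add: root_space_def)
    thus "x \<in> (\<Union>\<nu>. root_space {H0} \<nu>)" by blast
  qed
  moreover have "complex_vec.span {x. \<exists>c. lie H0 x = c *\<^sub>C x} = UNIV"
    using insert.prems by (simp add: ad_semisimple_def)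
  ultimately have "complex_vec.span (\<Union>\<nu>. root_space {H0} \<nu>) = (UNIV :: 'a set)"
    by (rule span_UNIV_mono)
  then obtain B where B: "B \<subseteq> (\<Union>\<nu>. root_space {H0} \<nu>)" "finite B"
     "complex_vec.independent B" "complex_vec.span B = (UNIV :: 'a set)"
    using basis_subset[OF fin] by metis
  then obtain w where w: "b \<in> root_space {H0} (w b)" if "b \<in> B" for b
    by (metis (no_types, lifting) UN_E subsetD)
  let ?rep = "complex_vec.representation B"
  define proj where "proj c x = (\<Sum>b | b \<in> B \<and> w b H0 = c. ?rep x b *\<^sub>C b)" for c x
  \<comment> \<open>\<open>lie H\<close> preserves the eigenspaces of \<open>H0\<close>, so its matrix has no entries between basis vectors
    with different eigenvalues.\<close>
  have comm: "lie H (proj c x) = proj c (lie H x)" if H: "H \<in> K" for H c x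
  proof -
    have "?rep x b * ?rep (lie H b) b' = 0" 
      if "b \<in> B" "b' \<in> B" "w b H0 \<noteq> w b' H0" for b b'
    proof (rule ccontr)
      assume "?rep x b * ?rep (lie H b) b' \<noteq> 0"
      hence nz: "?rep (lie H b) b' \<noteq> 0" by simp
      have "lie H0 H = 0" using insert.prems H by (auto simp: lie_abelian_def)
      hence "H \<in> root_space {H0} 0" by (simp add: root_space_def)
      hence "lie H b \<in> root_space {H0} (0 + w b)" using w that lie_root_space by blast
      hence "b' \<in> root_space {H0} (0 + w b)"
        using representation_eigen_component[OF B(3,4,2), of "{H0}"] w nz by blast
      moreover have "b' \<noteq> 0" using B(3) that complex_vec.dependent_zero by blast
      ultimately show False using w[OF that(2)] root_space_eq_on[of b' "{H0}" "0 + w b" "w b'" H0] that by simp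
    qed
    hence z: "w b' H0 = w b H0" if "b \<in> B" "b' \<in> B" "?rep (lie H b) b' \<noteq> 0" "?rep x b \<noteq> 0" for b b'
      using that by (metis mult_eq_0_iff)
    have ex: "(\<Sum>b\<in>B. ?rep y b *\<^sub>C b) = y" for y :: 'a
      using complex_vec.sum_representation_eq[of B y B] B by simp
    have "lie H x = (\<Sum>b\<in>B. lie H (?rep x b *\<^sub>C b))" by (simp only: ex flip: lie_sum_right)
    hence "?rep (lie H x) b' = (\<Sum>b\<in>B. ?rep x b * ?rep (lie H b) b')" for b'
      using B by (simp add: complex_vec.representation_sum complex_vec.representation_scale lie_scaleC_right)
    hence 1: "proj c (lie H x) = (\<Sum>b' | b' \<in> B \<and> w b' H0 = c. \<Sum>b\<in>B. (?rep x b * ?rep (lie H b) b') *\<^sub>C b')"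
      by (simp add: proj_def complex_vec.scale_sum_left)
    also have "\<dots> = (\<Sum>b' | b' \<in> B \<and> w b' H0 = c. \<Sum>b | b \<in> B \<and> w b H0 = c. (?rep x b * ?rep (lie H b) b') *\<^sub>C b')"
    proof (rule sum.cong[OF refl])
      fix b' assume "b' \<in> {b' \<in> B. w b' H0 = c}"
      with B show "(\<Sum>b\<in>B. (?rep x b * ?rep (lie H b) b') *\<^sub>C b') =
          (\<Sum>b | b \<in> B \<and> w b H0 = c. (?rep x b * ?rep (lie H b) b') *\<^sub>C b')"
        by (intro sum.mono_neutral_right) (use z in force)+
    qed
    also have "\<dots> = (\<Sum>b | b \<in> B \<and> w b H0 = c. \<Sum>b' | b' \<in> B \<and> w b' H0 = c. (?rep x b * ?rep (lie H b) b') *\<^sub>C b')"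
      by (rule sum.swap)
    also have "\<dots> = (\<Sum>b | b \<in> B \<and> w b H0 = c. \<Sum>b'\<in>B. (?rep x b * ?rep (lie H b) b') *\<^sub>C b')"
    proof (rule sum.cong[OF refl])
      fix b assume "b \<in> {b \<in> B. w b H0 = c}"
      with B show "(\<Sum>b' | b' \<in> B \<and> w b' H0 = c. (?rep x b * ?rep (lie H b) b') *\<^sub>C b') =
          (\<Sum>b'\<in>B. (?rep x b * ?rep (lie H b) b') *\<^sub>C b')"
        by (intro sum.mono_neutral_left) (use z in force)+
    qed
    also have "\<dots> = (\<Sum>b | b \<in> B \<and> w b H0 = c. ?rep x b *\<^sub>C lie H b)"
    proof (intro sum.cong refl)
      fix b
      have "(\<Sum>b'\<in>B. (?rep x b * ?rep (lie H b) b') *\<^sub>C b') = ?rep x b *\<^sub>C (\<Sum>b'\<in>B. ?rep (lie H b) b' *\<^sub>C b')"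
        by (simp add: complex_vec.scale_sum_right scaleC_scaleC)
      thus "(\<Sum>b'\<in>B. (?rep x b * ?rep (lie H b) b') *\<^sub>C b') = ?rep x b *\<^sub>C lie H b" by (simp only: ex)
    qed
    also have "\<dots> = lie H (proj c x)" by (simp add: proj_def lie_sum_right lie_scaleC_right)
    finally show ?thesis by simp
  qed
  have "root_space K \<nu> \<subseteq> complex_vec.span (\<Union>\<nu>. root_space (insert H0 K) \<nu>)" for \<nu>
  proof
    fix x assume x: "x \<in> root_space K \<nu>"
    have pr: "proj c x \<in> root_space (insert H0 K) (\<lambda>H. if H = H0 then c else \<nu> H)" for c
    proof -
      have "lie H0 (proj c x) = c *\<^sub>C proj c x"
        using w by (auto simp: proj_def lie_sum_right lie_scaleC_right complex_vec.scale_sum_right 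
             root_space_def scaleC_scaleC mult.commute intro!: sum.cong)
      moreover have "lie H (proj c x) = \<nu> H *\<^sub>C proj c x" if "H \<in> K" for H
      proof -
        have "lie H x = \<nu> H *\<^sub>C x" using x that by (simp add: root_space_def)
        hence "lie H (proj c x) = proj c (\<nu> H *\<^sub>C x)" using comm[OF that] by simp
        also have "\<dots> = \<nu> H *\<^sub>C proj c x"
          using B by (simp add: proj_def complex_vec.representation_scale complex_vec.scale_sum_right scaleC_scaleC)
        finally show ?thesis .
      qed
      ultimately show ?thesis using insert.hyps by (auto simp: root_space_def)
    qed
    have "(\<Sum>c\<in>(\<lambda>b. w b H0) ` B. proj c x) = (\<Sum>b\<in>B. ?rep x b *\<^sub>C b)"
      unfolding proj_def using sum.image_gen[OF B(2), of "\<lambda>b. ?rep x b *\<^sub>C b" "\<lambda>b. w b H0"] by simp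
    also have "\<dots> = x" using complex_vec.sum_representation_eq[of B x B] B by simp
    finally have "(\<Sum>c\<in>(\<lambda>b. w b H0) ` B. proj c x) = x" .
    moreover have "(\<Sum>c\<in>(\<lambda>b. w b H0) ` B. proj c x) \<in> complex_vec.span (\<Union>\<nu>. root_space (insert H0 K) \<nu>)"
      using pr by (intro complex_vec.span_sum complex_vec.span_base) blast
    ultimately show "x \<in> complex_vec.span (\<Union>\<nu>. root_space (insert H0 K) \<nu>)" by simp
  qed
  hence "complex_vec.span (\<Union>\<nu>. root_space K \<nu>) \<subseteq> complex_vec.span (\<Union>\<nu>. root_space (insert H0 K) \<nu>)"
    by (intro complex_vec.span_minimal) auto
  moreover have "complex_vec.span (\<Union>\<nu>. root_space K \<nu>) = (UNIV :: 'a set)"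
    using insert by (auto simp: lie_abelian_def)
  ultimately show ?case by auto
qed

section \<open>The root space decomposition\<close>

lemma dual_space_closed:
  "0 \<in> dual_space h" "f \<in> dual_space h \<Longrightarrow> g \<in> dual_space h \<Longrightarrow> f + g \<in> dual_space h"
  "f \<in> dual_space h \<Longrightarrow> - f \<in> dual_space h"
  by (auto simp: dual_space_def algebra_simps)

lemma dual_space_eqI:
  assumes "f \<in> dual_space h" "g \<in> dual_space h" "\<And>H. H \<in> h \<Longrightarrow> f H = g H"
  shows "f = g"
  using assms by (intro ext) (auto simp: dual_space_def, metis)

locale simple_with_cartan =
  fixes h :: "'g::complex_lie_algebra set"
  assumes fin_dim: "\<exists>B. finite B \<and> complex_vec.span B = (UNIV :: 'g set)"
    and simple: "lie_simple (UNIV :: 'g set)"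
    and cartan: "cartan_subalgebra h"
begin

lemma simple_ideal:
  assumes "complex_vec.subspace I" "\<And>x y. y \<in> I \<Longrightarrow> lie x y \<in> I"
  shows "I = {0} \<or> I = (UNIV :: 'g set)"
proof -
  have "lie_ideal I UNIV" using assms by (simp add: lie_ideal_def)
  thus ?thesis using simple by (auto simp: lie_simple_def)
qed

lemma nonabelian: "\<exists>x y :: 'g. lie x y \<noteq> 0"
  using simple by (auto simp: lie_simple_def lie_abelian_def)

lemma central_zero:
  assumes "\<And>y. lie y x = 0"
  shows "x = (0 :: 'g)"
proof -
  let ?Z = "{x :: 'g. \<forall>y. lie y x = 0}"
  have "complex_vec.subspace ?Z"
    by (auto simp: complex_vec.subspace_def lie_add_right lie_scaleC_right)
  hence "?Z = {0} \<or> ?Z = UNIV" by (rule simple_ideal) auto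
  moreover have "?Z \<noteq> UNIV" using nonabelian by blast
  ultimately show ?thesis using assms by blast
qed

lemma subspace_h: "complex_vec.subspace h"
  and h_comm: "H \<in> h \<Longrightarrow> H' \<in> h \<Longrightarrow> lie H H' = 0"
  using cartan by (auto simp: cartan_subalgebra_def lie_subalgebra_def lie_abelian_def)

text \<open>
  An element commuting with \<open>h\<close> spans together with \<open>h\<close> an abelian subalgebra, so it lies in \<open>h\<close> by
  maximality.
\<close>

lemma root_space_0: "root_space h 0 = h"
proof (intro equalityI subsetI)
  fix x assume x: "x \<in> root_space h 0"
  let ?S = "complex_vec.span (insert x h)"
  have z: "lie u v = 0" if "u \<in> insert x h" "v \<in> insert x h" for u v
  proof -
    have "lie H x = 0" "lie x H = 0" if "H \<in> h" for H
      using that x lie_anticomm[of x H] by (auto simp: root_space_def)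
    thus ?thesis using that h_comm lie_self by blast
  qed
  have ab: "lie u v = 0" if "u \<in> ?S" "v \<in> ?S" for u v
    using lie_span_span[of "{0}", OF _ _ that] z by (auto simp: complex_vec.subspace_single_0)
  hence "lie_subalgebra ?S" "lie_abelian ?S"
    by (auto simp: lie_subalgebra_def lie_abelian_def complex_vec.subspace_span complex_vec.span_zero)
  moreover have sup: "insert x h \<subseteq> ?S" by (rule complex_vec.span_superset)
  ultimately have "?S = h" using cartan by (auto simp: cartan_subalgebra_def)
  thus "x \<in> h" using sup by blast
qed (auto simp: root_space_def h_comm)

lemma roots_nonzero: "\<alpha> \<in> roots h \<Longrightarrow> \<alpha> \<noteq> 0" "\<alpha> \<in> roots h \<Longrightarrow> \<alpha> \<in> dual_space h"
  by (auto simp: roots_def)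

definition "weights = insert 0 (roots h)"

lemma weights_dual: "\<alpha> \<in> weights \<Longrightarrow> \<alpha> \<in> dual_space h"
  by (auto simp: weights_def roots_def dual_space_closed)

lemma weightsI: "\<alpha> \<in> dual_space h \<Longrightarrow> x \<in> root_space h \<alpha> \<Longrightarrow> x \<noteq> 0 \<Longrightarrow> \<alpha> \<in> weights"
  by (auto simp: weights_def roots_def)

text \<open>
  A finite basis \<open>K\<close> of \<open>h\<close> can be diagonalized simultaneously. A joint eigenvector of \<open>K\<close> is one of
  \<open>h\<close>, and its eigenvalues form a linear functional, extended by zero to match \<open>dual_space\<close>.
\<close>

lemma span_weight_spaces: "complex_vec.span (\<Union>\<alpha>\<in>weights. root_space h \<alpha>) = UNIV"
proof -
  obtain K where K: "K \<subseteq> h" "complex_vec.independent K" "h \<subseteq> complex_vec.span K"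
    using complex_vec.maximal_independent_subset[of h] by metis
  have finK: "finite K"
    using fin_dim K(2) complex_vec.independent_span_bound by (metis subset_UNIV)
  have "complex_vec.span (\<Union>\<nu>. root_space K \<nu>) = UNIV"
    using fin_dim finK K(1) cartan h_comm
    by (intro finite_simultaneous_diagonalization)
       (auto simp: cartan_subalgebra_def lie_abelian_def subset_iff)
  moreover have "root_space K \<nu> \<subseteq> (\<Union>\<alpha>\<in>weights. root_space h \<alpha>)" for \<nu>
  proof
    fix x assume x: "x \<in> root_space K \<nu>"
    show "x \<in> (\<Union>\<alpha>\<in>weights. root_space h \<alpha>)"
    proof (cases "x = 0")
      case True
      thus ?thesis using complex_vec.subspace_0[OF subspace_root_space] by (auto simp: weights_def)
    next
      case False
      let ?E = "{H. \<exists>c. lie H x = c *\<^sub>C x}"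
      have "complex_vec.subspace ?E"
        unfolding complex_vec.subspace_def
        by (auto simp: lie_add_left lie_scaleC_left scaleC_scaleC intro: exI[of _ 0])
           (metis scaleC_add_left)
      hence "complex_vec.span K \<subseteq> ?E"
        using x by (intro complex_vec.span_minimal) (auto simp: root_space_def)
      hence "\<exists>c. lie H x = c *\<^sub>C x" if "H \<in> h" for H using K(3) that by blast
      then obtain c where c: "lie H x = c H *\<^sub>C x" if "H \<in> h" for H by metis
      define \<mu> where "\<mu> H = (if H \<in> h then c H else 0)" for H
      have ev: "lie H x = \<mu> H *\<^sub>C x" if "H \<in> h" for H using c that by (simp add: \<mu>_def)
      have "\<mu> \<in> dual_space h"
        unfolding dual_space_def
      proof (intro CollectI conjI ballI allI impI)
        fix H H' assume "H \<in> h" "H' \<in> h"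
        moreover from this have "H + H' \<in> h" using subspace_h by (simp add: complex_vec.subspace_add)
        ultimately have "\<mu> (H + H') *\<^sub>C x = (\<mu> H + \<mu> H') *\<^sub>C x"
          using ev by (metis lie_add_left scaleC_add_left)
        thus "\<mu> (H + H') = \<mu> H + \<mu> H'" using False by simp
      next
        fix d H assume "H \<in> h"
        moreover from this have "d *\<^sub>C H \<in> h" using subspace_h by (simp add: complex_vec.subspace_scale)
        ultimately have "\<mu> (d *\<^sub>C H) *\<^sub>C x = (d * \<mu> H) *\<^sub>C x"
          using ev by (metis lie_scaleC_left scaleC_scaleC)
        thus "\<mu> (d *\<^sub>C H) = d * \<mu> H" using False by simp
      qed (simp add: \<mu>_def)
      moreover have "x \<in> root_space h \<mu>" using ev by (simp add: root_space_def)
      ultimately show ?thesis using weightsI False by blast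
    qed
  qed
  hence "(\<Union>\<nu>. root_space K \<nu>) \<subseteq> (\<Union>\<alpha>\<in>weights. root_space h \<alpha>)" by blast
  from span_UNIV_mono[OF this] calculation show ?thesis by blast
qed

definition "weight_basis = (SOME B. B \<subseteq> (\<Union>\<alpha>\<in>weights. root_space h \<alpha>) \<and> finite B \<and>
   complex_vec.independent B \<and> complex_vec.span B = (UNIV :: 'g set))"

lemma weight_basis:
  "weight_basis \<subseteq> (\<Union>\<alpha>\<in>weights. root_space h \<alpha>)" "finite weight_basis"
  "complex_vec.independent weight_basis" "complex_vec.span weight_basis = UNIV"
proof -
  have "\<exists>B. B \<subseteq> (\<Union>\<alpha>\<in>weights. root_space h \<alpha>) \<and> finite B \<and>
     complex_vec.independent B \<and> complex_vec.span B = (UNIV :: 'g set)"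
    using basis_subset[OF fin_dim span_weight_spaces] by metis
  from someI_ex[OF this, folded weight_basis_def]
  show "weight_basis \<subseteq> (\<Union>\<alpha>\<in>weights. root_space h \<alpha>)" "finite weight_basis"
  "complex_vec.independent weight_basis" "complex_vec.span weight_basis = UNIV" by auto
qed

definition "wt b = (SOME \<alpha>. \<alpha> \<in> weights \<and> b \<in> root_space h \<alpha>)"

lemma wt: "b \<in> weight_basis \<Longrightarrow> wt b \<in> weights" "b \<in> weight_basis \<Longrightarrow> b \<in> root_space h (wt b)"
proof -
  assume "b \<in> weight_basis"
  hence "\<exists>\<alpha>. \<alpha> \<in> weights \<and> b \<in> root_space h \<alpha>" using weight_basis(1) by blast
  from someI_ex[OF this, folded wt_def] show "wt b \<in> weights" "b \<in> root_space h (wt b)" by auto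
qed

abbreviation coord :: "'g \<Rightarrow> 'g \<Rightarrow> complex" where
  "coord \<equiv> complex_vec.representation weight_basis"

lemma coord_add: "coord (x + y) b = coord x b + coord y b"
  using weight_basis by (simp add: complex_vec.representation_add)

lemma coord_diff: "coord (x - y) b = coord x b - coord y b"
  using weight_basis by (simp add: complex_vec.representation_diff)

lemma coord_scale: "coord (c *\<^sub>C x) b = c * coord x b"
  using weight_basis by (simp add: complex_vec.representation_scale)

lemma coord_sum: "coord (sum f A) b = (\<Sum>a\<in>A. coord (f a) b)"
  using weight_basis by (simp add: complex_vec.representation_sum)

lemma coord_expand: "(\<Sum>b\<in>weight_basis. coord x b *\<^sub>C b) = x"
  using complex_vec.sum_representation_eq[of weight_basis x weight_basis] weight_basis by simp

lemma coord_nonzero_exists: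
  assumes "x \<noteq> 0"
  shows "\<exists>b. coord x b \<noteq> 0"
proof (rule ccontr)
  assume "\<nexists>b. coord x b \<noteq> 0"
  hence "(\<Sum>b\<in>weight_basis. coord x b *\<^sub>C b) = 0" by simp
  thus False using assms by (simp only: coord_expand)
qed

lemma coord_nz_basis: "coord x b \<noteq> 0 \<Longrightarrow> b \<in> weight_basis"
  by (rule complex_vec.representation_ne_zero)

lemma coord_basis: "b \<in> weight_basis \<Longrightarrow> coord b c = (if c = b then 1 else 0)"
  using weight_basis(3) by (subst complex_vec.representation_basis) auto

lemma coord_wt:
  assumes "x \<in> root_space h \<alpha>" "\<alpha> \<in> dual_space h" "coord x b \<noteq> 0"
  shows "wt b = \<alpha>"
proof (rule dual_space_eqI)
  have b: "b \<in> weight_basis" using assms(3) by (rule coord_nz_basis)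
  show "wt b \<in> dual_space h" using wt(1)[OF b] by (rule weights_dual)
  have "b \<in> root_space h \<alpha>"
    using representation_eigen_component[OF weight_basis(3,4,2), of h] wt assms by blast
  moreover have "b \<noteq> 0" using b weight_basis(3) complex_vec.dependent_zero by blast
  ultimately show "wt b H = \<alpha> H" if "H \<in> h" for H
    using root_space_eq_on[OF wt(2)[OF b]] that by blast
qed (use assms in auto)

definition weight_span :: "('g \<Rightarrow> complex) set \<Rightarrow> 'g set" where
  "weight_span A = complex_vec.span (\<Union>\<alpha>\<in>A. root_space h \<alpha>)"

lemma weight_span_base: "x \<in> root_space h \<alpha> \<Longrightarrow> \<alpha> \<in> A \<Longrightarrow> x \<in> weight_span A"
  unfolding weight_span_def by (rule complex_vec.span_base) blast

lemma subspace_weight_span: "complex_vec.subspace (weight_span A)"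
  unfolding weight_span_def by (rule complex_vec.subspace_span)

lemma weight_span_minimal:
  "complex_vec.subspace S \<Longrightarrow> (\<And>\<alpha> x. \<alpha> \<in> A \<Longrightarrow> x \<in> root_space h \<alpha> \<Longrightarrow> x \<in> S) \<Longrightarrow> weight_span A \<subseteq> S"
  unfolding weight_span_def by (rule complex_vec.span_minimal) blast

lemma weight_span_mono: "A \<subseteq> A' \<Longrightarrow> weight_span A \<subseteq> weight_span A'"
  unfolding weight_span_def by (rule complex_vec.span_mono) blast

lemma coord_weight_span:
  assumes "x \<in> weight_span A" "A \<subseteq> dual_space h" "coord x b \<noteq> 0"
  shows "wt b \<in> A"
proof (rule ccontr)
  assume "wt b \<notin> A"
  have "weight_span A \<subseteq> {x. coord x b = 0}"
  proof (rule weight_span_minimal)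
    show "complex_vec.subspace {x. coord x b = 0}"
      by (auto simp: complex_vec.subspace_def coord_add coord_scale complex_vec.representation_zero)
    show "x \<in> {x. coord x b = 0}" if "\<alpha> \<in> A" "x \<in> root_space h \<alpha>" for \<alpha> x
      using coord_wt[OF that(2)] assms(2) that \<open>wt b \<notin> A\<close> by blast
  qed
  with assms show False by blast
qed

lemma weight_span_disjoint:
  assumes "x \<in> weight_span A" "x \<in> weight_span A'" "A \<subseteq> dual_space h" "A' \<subseteq> dual_space h" "A \<inter> A' = {}"
  shows "x = 0"
proof -
  have "coord x b = 0" for b using coord_weight_span[of x] assms by blast
  thus ?thesis using coord_expand[of x] by simp
qed

lemma weight_span_weights: "weight_span weights = UNIV"
  unfolding weight_span_def by (rule span_weight_spaces)

lemma finite_roots: "finite (roots h)"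
proof -
  have "roots h \<subseteq> wt ` weight_basis"
  proof
    fix \<alpha> assume \<alpha>: "\<alpha> \<in> roots h"
    then obtain x where x: "x \<in> root_space h \<alpha>" "x \<noteq> 0"
      using complex_vec.subspace_0[OF subspace_root_space, of h \<alpha>] by (auto simp: roots_def)
    obtain b where b: "coord x b \<noteq> 0"
      using x(2) coord_nonzero_exists by blast
    thus "\<alpha> \<in> wt ` weight_basis"
      using coord_wt[OF x(1) _ b] \<alpha> coord_nz_basis[OF b] by (auto simp: roots_def)
  qed
  thus ?thesis using weight_basis(2) by (rule finite_subset[OF _ finite_imageI])
qed

lemma lie_weight_span:
  assumes "x \<in> weight_span A" "y \<in> weight_span A'" "A \<subseteq> dual_space h" "A' \<subseteq> dual_space h"
    and "\<And>\<alpha> \<beta>. \<alpha> \<in> A \<Longrightarrow> \<beta> \<in> A' \<Longrightarrow> \<alpha> + \<beta> \<in> weights \<Longrightarrow> \<alpha> + \<beta> \<in> C"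
  shows "lie x y \<in> weight_span C"
proof (rule lie_span_span[OF subspace_weight_span])
  show "x \<in> complex_vec.span (\<Union>\<alpha>\<in>A. root_space h \<alpha>)" using assms by (simp add: weight_span_def)
  show "y \<in> complex_vec.span (\<Union>\<alpha>\<in>A'. root_space h \<alpha>)" using assms by (simp add: weight_span_def)
  fix u v assume "u \<in> (\<Union>\<alpha>\<in>A. root_space h \<alpha>)" "v \<in> (\<Union>\<alpha>\<in>A'. root_space h \<alpha>)"
  then obtain \<alpha> \<beta> where ab: "\<alpha> \<in> A" "\<beta> \<in> A'" "u \<in> root_space h \<alpha>" "v \<in> root_space h \<beta>" by blast
  hence uv: "lie u v \<in> root_space h (\<alpha> + \<beta>)" by (intro lie_root_space)
  show "lie u v \<in> weight_span C"
  proof (cases "lie u v = 0")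
    case True thus ?thesis using complex_vec.subspace_0[OF subspace_weight_span] by simp
  next
    case False
    have "\<alpha> + \<beta> \<in> dual_space h" using ab assms(3,4) by (auto intro!: dual_space_closed)
    hence "\<alpha> + \<beta> \<in> weights" using weightsI uv False by blast
    thus ?thesis using weight_span_base[OF uv] assms(5) ab by blast
  qed
qed

text \<open>
  If every element of the algebra is a sum of an element of \<open>P\<close> and one that kills \<open>T0\<close>, then the
  smallest \<open>P\<close>-stable subspace containing \<open>T0\<close> is an ideal. This plays the part of the factorization
  \<open>U(\<gg>) = U(P) U(\<nn>\<^sup>-)\<close> of the enveloping algebra.
\<close>

lemma generated_by_annihilated:
  fixes T0 S P :: "'g set"
  assumes dec: "\<And>x. \<exists>a\<in>P. \<exists>b. x = a + b \<and> (\<forall>t\<in>T0. lie b t = 0)"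
    and S: "complex_vec.subspace S" "\<And>a s. a \<in> P \<Longrightarrow> s \<in> S \<Longrightarrow> lie a s \<in> S"
    and T0: "T0 \<subseteq> S" "t \<in> T0" "t \<noteq> 0"
  shows "S = UNIV"
proof -
  define good where "good U \<longleftrightarrow> complex_vec.subspace U \<and> (\<forall>a\<in>P. \<forall>u\<in>U. lie a u \<in> U) \<and> T0 \<subseteq> U" for U
  define T where "T = \<Inter> (Collect good)"
  have gT: "good T"
    unfolding T_def good_def
    by (auto simp: good_def complex_vec.subspace_def)
  have min: "T \<subseteq> U" if "good U" for U using that by (auto simp: T_def)
  \<comment> \<open>The vectors moved into \<open>T\<close> by the whole algebra again form a \<open>P\<close>-stable subspace
    containing \<open>T0\<close>, so minimality makes \<open>T\<close> an ideal.\<close>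
  define T' where "T' = {t\<in>T. \<forall>y. lie y t \<in> T}"
  have "good T'"
    unfolding good_def
  proof (intro conjI ballI)
    show "complex_vec.subspace T'"
      using gT by (auto simp: T'_def good_def complex_vec.subspace_def lie_add_right lie_scaleC_right)
    show "lie a u \<in> T'" if "a \<in> P" "u \<in> T'" for a u
    proof -
      have "lie y (lie a u) \<in> T" for y
      proof -
        have "lie (lie y a) u \<in> T" "lie a (lie y u) \<in> T"
          using that gT by (auto simp: T'_def good_def)
        thus ?thesis using gT by (subst lie_leibniz) (auto simp: good_def complex_vec.subspace_add)
      qed
      thus ?thesis using that by (auto simp: T'_def)
    qed
    show "T0 \<subseteq> T'"
    proof
      fix t assume t: "t \<in> T0"
      have "lie y t \<in> T" for y
      proof -
        obtain a b where "a \<in> P" "y = a + b" "lie b t = 0" using dec t by blast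
        thus ?thesis using gT t by (auto simp: lie_add_left good_def)
      qed
      thus "t \<in> T'" using gT t by (auto simp: T'_def good_def)
    qed
  qed
  hence "T \<subseteq> T'" by (rule min)
  hence "T = {0} \<or> T = UNIV"
    using gT by (intro simple_ideal) (auto simp: T'_def good_def)
  moreover have "T \<noteq> {0}" using T0 gT by (auto simp: good_def)
  moreover have "T \<subseteq> S" using S T0 by (intro min) (auto simp: good_def)
  ultimately show ?thesis by auto
qed

section \<open>The Killing form and the symmetry of the root system\<close>

text \<open>
  The only instance of linearity that the trace argument applies.
\<close>

definition expands :: "('g \<Rightarrow> 'g) \<Rightarrow> bool" where
  "expands f \<longleftrightarrow> (\<forall>r. f (\<Sum>b\<in>weight_basis. r b *\<^sub>C b) = (\<Sum>b\<in>weight_basis. r b *\<^sub>C f b))"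

lemma expands_lie: "expands (lie x)" "expands (\<lambda>z. lie x (lie y z))"
  by (simp_all add: expands_def lie_sum_right lie_scaleC_right)

text \<open>
  The identity \<open>tr (f g) = tr (g f)\<close>, on the span of a subset \<open>C\<close> of the weight basis that both maps
  preserve. With all of the basis it gives invariance of the Killing form, with a root string the
  vanishing of the trace of a commutator there.
\<close>

lemma trace_comm:
  assumes "expands f" "expands g" "C \<subseteq> weight_basis"
    and "\<And>b c. b \<in> C \<Longrightarrow> coord (f b) c \<noteq> 0 \<Longrightarrow> c \<in> C"
    and "\<And>b c. b \<in> C \<Longrightarrow> coord (g b) c \<noteq> 0 \<Longrightarrow> c \<in> C"
  shows "(\<Sum>b\<in>C. coord (f (g b)) b) = (\<Sum>b\<in>C. coord (g (f b)) b)"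
proof -
  have *: "coord (p (q b)) b = (\<Sum>c\<in>C. coord (q b) c * coord (p c) b)"
    if "expands p" "b \<in> C" "\<And>c. coord (q b) c \<noteq> 0 \<Longrightarrow> c \<in> C" for p q b
  proof -
    have "p (q b) = (\<Sum>c\<in>weight_basis. coord (q b) c *\<^sub>C p c)"
      using that(1)[unfolded expands_def, rule_format, of "coord (q b)"] by (simp only: coord_expand)
    hence "coord (p (q b)) b = (\<Sum>c\<in>weight_basis. coord (q b) c * coord (p c) b)"
      by (simp add: coord_sum coord_scale)
    also have "\<dots> = (\<Sum>c\<in>C. coord (q b) c * coord (p c) b)"
      using that(3) assms(3) weight_basis(2) by (intro sum.mono_neutral_right) auto
    finally show ?thesis .
  qed
  have "(\<Sum>b\<in>C. coord (f (g b)) b) = (\<Sum>b\<in>C. \<Sum>c\<in>C. coord (g b) c * coord (f c) b)"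
    using assms(1,4,5) by (intro sum.cong refl *[where p = f and q = g])
  also have "\<dots> = (\<Sum>c\<in>C. \<Sum>b\<in>C. coord (g b) c * coord (f c) b)" by (rule sum.swap)
  also have "\<dots> = (\<Sum>b\<in>C. \<Sum>c\<in>C. coord (f b) c * coord (g c) b)"
    by (intro sum.cong refl) (rule mult.commute)
  also have "\<dots> = (\<Sum>b\<in>C. coord (g (f b)) b)"
    using assms(2,4,5) by (intro sum.cong refl *[where p = g and q = f, symmetric])
  finally show ?thesis .
qed

definition killing :: "'g \<Rightarrow> 'g \<Rightarrow> complex" where
  "killing x y = (\<Sum>b\<in>weight_basis. coord (lie x (lie y b)) b)"

lemma killing_invariant: "killing (lie z x) y = killing x (lie y z)"
proof -
  have "(\<Sum>b\<in>weight_basis. coord (lie z (lie x (lie y b))) b) = (\<Sum>b\<in>weight_basis. coord (lie x (lie y (lie z b))) b)"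
    by (rule trace_comm[of "lie z" "\<lambda>b. lie x (lie y b)"]) (auto intro: expands_lie coord_nz_basis)
  moreover have "lie (lie z x) w = lie z (lie x w) - lie x (lie z w)"
      "lie (lie y z) w = lie y (lie z w) - lie z (lie y w)" for w :: 'g
    using lie_leibniz[of z x w] lie_leibniz[of y z w] by simp_all
  ultimately show ?thesis
    by (simp add: killing_def lie_diff_right coord_diff sum_subtractf)
qed

lemma killing_linear:
  "killing 0 z = 0" "killing (x + y) z = killing x z + killing y z"
  "killing (c *\<^sub>C x) z = c * killing x z"
  "killing z 0 = 0" "killing z (x + y) = killing z x + killing z y"
  "killing z (c *\<^sub>C x) = c * killing z x"
  by (simp_all add: killing_def lie_add_left lie_add_right lie_scaleC_left lie_scaleC_right
      coord_add coord_scale sum.distrib sum_distrib_left complex_vec.representation_zero)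

text \<open>
  For \<open>u\<close> in the root space of \<open>\<alpha>\<close> and \<open>y\<close> of weight \<open>\<beta>\<close>, the product \<open>ad u ad y\<close> shifts weights by
  \<open>\<alpha> + \<beta>\<close>, so its trace vanishes unless \<open>\<beta> = - \<alpha>\<close>. If \<open>- \<alpha>\<close> is not a root, then \<open>u\<close> lies in the
  radical of the form; the radical is an ideal, hence everything.
\<close>

lemma killing_zero_if_no_opposite:
  assumes "\<alpha> \<in> roots h" "- \<alpha> \<notin> roots h"
  shows "killing x y = 0"
proof -
  let ?I = "{x. \<forall>y. killing x y = 0}"
  have I: "complex_vec.subspace ?I"
    by (simp add: complex_vec.subspace_def killing_linear)
  have "?I = {0} \<or> ?I = UNIV"
    using I by (rule simple_ideal) (simp add: killing_invariant)
  moreover obtain u where u: "u \<in> root_space h \<alpha>" "u \<noteq> 0"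
    using assms complex_vec.subspace_0[OF subspace_root_space, of h \<alpha>] by (auto simp: roots_def)
  have "u \<in> ?I"
  proof (intro CollectI allI)
    fix y
    have "weight_span weights \<subseteq> {y. killing u y = 0}"
    proof (rule weight_span_minimal)
      show "complex_vec.subspace {y. killing u y = 0}"
        by (simp add: complex_vec.subspace_def killing_linear)
      fix \<beta> y assume b: "\<beta> \<in> weights" "y \<in> root_space h \<beta>"
      have "coord (lie u (lie y b)) b = 0" if b': "b \<in> weight_basis" for b
      proof (rule ccontr)
        assume nz: "coord (lie u (lie y b)) b \<noteq> 0"
        have "lie u (lie y b) \<in> root_space h (\<alpha> + (\<beta> + wt b))"
          using u b wt b' by (intro lie_root_space)
        hence "wt b = \<alpha> + (\<beta> + wt b)"
          using nz assms(1) b(1) b' wt(1)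
          by (intro coord_wt) (auto intro: dual_space_closed weights_dual roots_nonzero)
        hence "\<beta> = - \<alpha>" by (simp add: algebra_simps add_eq_0_iff)
        thus False using b assms by (auto simp: weights_def roots_def)
      qed
      thus "y \<in> {y. killing u y = 0}" by (simp add: killing_def)
    qed
    thus "killing u y = 0" using weight_span_weights by blast
  qed
  ultimately show ?thesis using u(2) by blast
qed


lemma root_vector_exists: "\<alpha> \<in> roots h \<Longrightarrow> \<exists>x\<in>root_space h \<alpha>. x \<noteq> 0"
  using complex_vec.subspace_0[OF subspace_root_space, of h \<alpha>] by (auto simp: roots_def)

text \<open>
  On the sum of the weight spaces along the string \<open>wt b + \<int> \<alpha>\<close> the element \<open>lie x y\<close> acts as a
  commutator, hence with trace zero. Since its eigenvalues there are
  \<open>wt b (lie x y) + j \<alpha> (lie x y)\<close> with integers \<open>j\<close>, their sum being zero makes the first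
  summand a rational multiple of \<open>\<alpha> (lie x y)\<close>.
\<close>

lemma string_trace:
  assumes x: "x \<in> root_space h \<alpha>" "y \<in> root_space h (- \<alpha>)" and \<alpha>: "\<alpha> \<in> roots h"
    and b: "b \<in> weight_basis"
  shows "\<exists>q::real. wt b (lie x y) = of_real q * \<alpha> (lie x y)"
proof -
  define H where "H = lie x y"
  define C where "C = {c \<in> weight_basis. \<exists>j::int. wt c = (\<lambda>K. wt b K + of_int j * \<alpha> K)}"
  have finC: "finite C" using weight_basis(2) by (simp add: C_def)
  have "wt b = (\<lambda>K. wt b K + of_int 0 * \<alpha> K)" by simp
  hence bC: "b \<in> C" unfolding C_def using b by blast
  have "\<forall>c\<in>C. \<exists>j::int. wt c = (\<lambda>K. wt b K + of_int j * \<alpha> K)" unfolding C_def by blast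
  from bchoice[OF this] obtain j :: "'g \<Rightarrow> int"
    where j: "wt c = (\<lambda>K. wt b K + of_int (j c) * \<alpha> K)" if "c \<in> C" for c by blast
  have d: "\<alpha> \<in> dual_space h" "- \<alpha> \<in> dual_space h" using \<alpha> by (auto intro: roots_nonzero dual_space_closed)
  have "H \<in> root_space h (\<alpha> + - \<alpha>)" unfolding H_def using x by (rule lie_root_space)
  hence Hh: "H \<in> h" using root_space_0 by simp
  have px: "c' \<in> C" if "c \<in> C" "coord (lie x c) c' \<noteq> 0" for c c'
  proof -
    have "c \<in> weight_basis" using that by (simp add: C_def)
    hence "wt c' = \<alpha> + wt c"
      using coord_wt[OF lie_root_space[OF x(1) wt(2)] _ that(2)] wt(1) weights_dual d dual_space_closed by metis
    hence "wt c' = (\<lambda>K. wt b K + of_int (j c + 1) * \<alpha> K)"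
      using j[OF that(1)] by (simp add: fun_eq_iff algebra_simps)
    thus ?thesis unfolding C_def using coord_nz_basis[OF that(2)] by blast
  qed
  have py: "c' \<in> C" if "c \<in> C" "coord (lie y c) c' \<noteq> 0" for c c'
  proof -
    have "c \<in> weight_basis" using that by (simp add: C_def)
    hence "wt c' = - \<alpha> + wt c"
      using coord_wt[OF lie_root_space[OF x(2) wt(2)] _ that(2)] wt(1) weights_dual d dual_space_closed by metis
    hence "wt c' = (\<lambda>K. wt b K + of_int (j c - 1) * \<alpha> K)"
      using j[OF that(1)] by (simp add: fun_eq_iff algebra_simps)
    thus ?thesis unfolding C_def using coord_nz_basis[OF that(2)] by blast
  qed
  have "(\<Sum>c\<in>C. wt c H) = (\<Sum>c\<in>C. coord (lie H c) c)"
  proof (rule sum.cong[OF refl])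
    fix c assume "c \<in> C"
    hence c: "c \<in> weight_basis" by (simp add: C_def)
    hence "lie H c = wt c H *\<^sub>C c" using wt(2) Hh by (simp add: root_space_def)
    thus "wt c H = coord (lie H c) c" using c by (simp add: coord_scale coord_basis)
  qed
  also have "\<dots> = (\<Sum>c\<in>C. coord (lie x (lie y c)) c - coord (lie y (lie x c)) c)"
  proof (rule sum.cong[OF refl])
    fix c
    have "lie H c = lie x (lie y c) - lie y (lie x c)"
      unfolding H_def using lie_leibniz[of x y c] by simp
    thus "coord (lie H c) c = coord (lie x (lie y c)) c - coord (lie y (lie x c)) c" by (simp add: coord_diff)
  qed
  also have "\<dots> = 0"
    unfolding sum_subtractf
    using trace_comm[of "lie x" "lie y" C, OF expands_lie(1) expands_lie(1) _ px py] by (simp add: C_def)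
  finally have "(\<Sum>c\<in>C. wt b H + of_int (j c) * \<alpha> H) = 0" using j by (simp cong: sum.cong)
  hence "of_nat (card C) * wt b H = - of_int (\<Sum>c\<in>C. j c) * \<alpha> H"
    by (simp add: sum.distrib add_eq_0_iff flip: sum_distrib_right)
  moreover have "card C \<noteq> 0" using bC finC by auto
  ultimately have "wt b H = of_real (- of_int (\<Sum>c\<in>C. j c) / of_nat (card C)) * \<alpha> H"
    by (simp add: field_simps)
  thus ?thesis unfolding H_def by blast
qed

text \<open>
  Otherwise the Killing form vanishes. For \<open>H = lie x y\<close> with \<open>x\<close>, \<open>y\<close> in opposite root spaces,
  \<open>killing H H\<close> is the square of \<open>\<beta> H\<close> times a sum of squares of real numbers, which is positive
  if \<open>\<beta> H \<noteq> 0\<close>, since the root \<open>\<beta>\<close> itself contributes 1; so \<open>\<beta> H = 0\<close>, all weights vanish on \<open>H\<close>, and \<open>H\<close> is central, i.e. zero. Then the root spaces alone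
  span an ideal containing all brackets, which leaves no room for \<open>h\<close>.
\<close>

theorem roots_uminus:
  assumes "\<alpha> \<in> roots h"
  shows "- \<alpha> \<in> roots h"
proof (rule ccontr)
  assume neg: "- \<alpha> \<notin> roots h"
  have kz: "killing x y = 0" for x y using killing_zero_if_no_opposite assms neg by blast
  have z: "lie x y = 0" if b: "\<beta> \<in> roots h" and x: "x \<in> root_space h \<beta>" "y \<in> root_space h (- \<beta>)" for \<beta> x y
  proof -
    let ?H = "lie x y"
    have "?H \<in> root_space h (\<beta> + - \<beta>)" using x by (rule lie_root_space)
    hence Hh: "?H \<in> h" using root_space_0 by simp
    obtain q :: "'g \<Rightarrow> real" where q: "wt b ?H = of_real (q b) * \<beta> ?H" if "b \<in> weight_basis" for b
      using string_trace[OF x b] by metis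
    have ev: "lie ?H b = wt b ?H *\<^sub>C b" if "b \<in> weight_basis" for b
      using wt(2)[OF that] Hh by (simp add: root_space_def)
    have "killing ?H ?H = (\<Sum>b\<in>weight_basis. (wt b ?H)\<^sup>2)"
      unfolding killing_def
      by (intro sum.cong refl) (simp add: ev lie_scaleC_right coord_scale coord_basis power2_eq_square)
    also have "\<dots> = (\<Sum>b\<in>weight_basis. of_real ((q b)\<^sup>2) * (\<beta> ?H)\<^sup>2)"
      by (intro sum.cong refl) (simp add: q power_mult_distrib)
    also have "\<dots> = of_real (\<Sum>b\<in>weight_basis. (q b)\<^sup>2) * (\<beta> ?H)\<^sup>2" by (simp add: sum_distrib_right)
    finally have eq: "of_real (\<Sum>b\<in>weight_basis. (q b)\<^sup>2) * (\<beta> ?H)\<^sup>2 = 0" using kz by simp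
    have "\<beta> ?H = 0"
    proof (rule ccontr)
      assume nz: "\<beta> ?H \<noteq> 0"
      with eq have "complex_of_real (\<Sum>b\<in>weight_basis. (q b)\<^sup>2) = 0" by (simp del: of_real_sum)
      hence "(\<Sum>b\<in>weight_basis. (q b)\<^sup>2) = 0" by (simp only: of_real_eq_0_iff)
      hence q0: "q b = 0" if "b \<in> weight_basis" for b
        using that weight_basis(2) by (simp add: sum_nonneg_eq_0_iff)
      obtain u where u: "u \<in> root_space h \<beta>" "u \<noteq> 0" using root_vector_exists b by blast
      obtain b0 where b0: "coord u b0 \<noteq> 0"
        using u(2) coord_nonzero_exists by blast
      have "wt b0 = \<beta>" using coord_wt[OF u(1) _ b0] roots_nonzero b by blast
      thus False using q[OF coord_nz_basis[OF b0]] q0[OF coord_nz_basis[OF b0]] nz by simp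
    qed
    hence "lie ?H b = 0" if "b \<in> weight_basis" for b using ev q that by simp
    hence "lie ?H w = 0" for w
      using coord_expand[of w] lie_sum_right[of ?H "\<lambda>b. coord w b *\<^sub>C b" weight_basis]
      by (simp add: lie_scaleC_right)
    hence "lie w ?H = 0" for w using lie_anticomm[of ?H w] by simp
    thus ?thesis by (rule central_zero)
  qed
  let ?I = "weight_span (roots h)"
  have br: "lie u v \<in> ?I" if uv: "u \<in> root_space h \<beta>" "v \<in> root_space h \<gamma>" "\<beta> \<in> weights" "\<gamma> \<in> weights" for u v \<beta> \<gamma>
  proof (cases "\<beta> + \<gamma> = 0 \<or> lie u v = 0")
    case True
    have "lie u v = 0"
    proof (cases "\<beta> = 0")
      case True
      with \<open>_ \<or> _\<close> uv show ?thesis using h_comm root_space_0 by auto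
    next
      case False
      with \<open>_ \<or> _\<close> uv show ?thesis using z by (auto simp: add_eq_0_iff weights_def)
    qed
    thus ?thesis using complex_vec.subspace_0[OF subspace_weight_span] by simp
  next
    case False
    have "lie u v \<in> root_space h (\<beta> + \<gamma>)" using uv by (intro lie_root_space)
    moreover have "\<beta> + \<gamma> \<in> dual_space h" using uv by (auto intro: dual_space_closed weights_dual)
    hence "\<beta> + \<gamma> \<in> roots h"
      using weightsI[OF _ calculation] False by (auto simp: weights_def)
    ultimately show ?thesis by (rule weight_span_base)
  qed
  have br': "lie u v \<in> ?I" for u v
    by (rule lie_span_span[OF subspace_weight_span, of "\<Union>\<alpha>\<in>weights. root_space h \<alpha>" "\<Union>\<alpha>\<in>weights. root_space h \<alpha>"])
       (use br span_weight_spaces in auto)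
  hence "?I = {0} \<or> ?I = UNIV" by (intro simple_ideal subspace_weight_span) auto
  moreover have "?I \<noteq> {0}" using nonabelian br' by (metis singletonD)
  ultimately have I: "?I = UNIV" by blast
  have "H = 0" if "H \<in> h" for H
  proof (rule weight_span_disjoint[of H "roots h" "{0}"])
    show "H \<in> weight_span (roots h)" using I by simp
    show "H \<in> weight_span {0}" using that root_space_0 weight_span_base by blast
  qed (use roots_nonzero dual_space_closed in auto)
  moreover have "\<exists>H\<in>h. \<alpha> H \<noteq> 0"
    using dual_space_eqI[OF roots_nonzero(2)[OF assms] dual_space_closed(1)] roots_nonzero(1)[OF assms]
    by auto
  moreover have "\<alpha> 0 = 0"
  proof -
    have "0 \<in> h" using subspace_h by (rule complex_vec.subspace_0)
    hence "\<alpha> (0 *\<^sub>C 0) = 0 * \<alpha> 0" using assms unfolding roots_def dual_space_def by blast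
    thus ?thesis by simp
  qed
  ultimately show False by metis
qed

end

section \<open>Levels of roots\<close>

lemma lincomb_add: "lincomb (\<lambda>\<gamma>. c \<gamma> + d \<gamma>) B = lincomb c B + lincomb d B"
  by (auto simp: lincomb_def fun_eq_iff algebra_simps sum.distrib)

lemma lincomb_uminus: "lincomb (\<lambda>\<gamma>. - c \<gamma>) B = - lincomb c B"
  by (auto simp: lincomb_def fun_eq_iff sum_negf)

lemma lincomb_zero: "lincomb (\<lambda>_. 0) B = 0"
  by (auto simp: lincomb_def fun_eq_iff)

lemma lincomb_single:
  assumes "finite B" "\<gamma> \<in> B"
  shows "lincomb (\<lambda>\<delta>. if \<delta> = \<gamma> then 1 else 0) B = \<gamma>"
proof
  fix H
  have "lincomb (\<lambda>\<delta>. if \<delta> = \<gamma> then 1 else 0) B H = (\<Sum>\<delta>\<in>B. if \<delta> = \<gamma> then \<delta> H else 0)"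
    unfolding lincomb_def by (intro sum.cong) auto
  thus "lincomb (\<lambda>\<delta>. if \<delta> = \<gamma> then 1 else 0) B H = \<gamma> H" using assms by simp
qed

lemma lincomb_superset:
  assumes "finite B" "B' \<subseteq> B" "\<And>\<gamma>. \<gamma> \<in> B - B' \<Longrightarrow> c \<gamma> = 0"
  shows "lincomb c B = lincomb c B'"
  unfolding lincomb_def using assms by (intro ext sum.mono_neutral_right) auto

lemma lincomb_cong: "(\<And>\<gamma>. \<gamma> \<in> B \<Longrightarrow> c \<gamma> = d \<gamma>) \<Longrightarrow> lincomb c B = lincomb d B"
  unfolding lincomb_def by (intro ext sum.cong) auto

locale simple_with_root_basis = simple_with_cartan h for h :: "'g::complex_lie_algebra set" +
  fixes Pi :: "('g \<Rightarrow> complex) set"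
  assumes basis: "root_basis h Pi"
begin

lemma finite_Pi: "finite Pi" and Pi_roots: "Pi \<subseteq> roots h"
  using basis by (auto simp: root_basis_def)

text \<open>
  The coefficients are unique by linear independence over the reals. They stand in for an element of
  \<open>h\<close> on which the simple roots take prescribed values, whose existence would rest on independence
  over the complex numbers.
\<close>

definition coef :: "('g \<Rightarrow> complex) \<Rightarrow> ('g \<Rightarrow> complex) \<Rightarrow> real" where
  "coef \<alpha> = (SOME c. \<alpha> = lincomb c Pi)"

lemma coef_eq:
  assumes "\<alpha> = lincomb c Pi" "\<gamma> \<in> Pi"
  shows "coef \<alpha> \<gamma> = c \<gamma>"
proof -
  have "\<exists>c. \<alpha> = lincomb c Pi" using assms(1) by blast
  from someI_ex[OF this] have "\<alpha> = lincomb (coef \<alpha>) Pi" unfolding coef_def .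
  hence "lincomb (\<lambda>\<gamma>. coef \<alpha> \<gamma> + - c \<gamma>) Pi = 0"
    unfolding lincomb_add lincomb_uminus using assms(1) by simp
  hence "coef \<alpha> \<gamma> + - c \<gamma> = 0" using basis assms(2) unfolding root_basis_def by blast
  thus ?thesis by simp
qed

lemma root_coef:
  assumes "\<alpha> \<in> roots h"
  shows "lincomb (coef \<alpha>) Pi = \<alpha>" "\<And>\<gamma>. \<gamma> \<in> Pi \<Longrightarrow> coef \<alpha> \<gamma> \<in> \<int>"
    "(\<forall>\<gamma>\<in>Pi. coef \<alpha> \<gamma> \<ge> 0) \<or> (\<forall>\<gamma>\<in>Pi. coef \<alpha> \<gamma> \<le> 0)"
proof -
  obtain c where c: "\<alpha> = lincomb c Pi" "\<forall>\<gamma>\<in>Pi. c \<gamma> \<in> \<int>"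
      "(\<forall>\<gamma>\<in>Pi. c \<gamma> \<ge> 0) \<or> (\<forall>\<gamma>\<in>Pi. c \<gamma> \<le> 0)"
    using basis assms unfolding root_basis_def by blast
  have eq: "coef \<alpha> \<gamma> = c \<gamma>" if "\<gamma> \<in> Pi" for \<gamma> using coef_eq c(1) that by blast
  show "lincomb (coef \<alpha>) Pi = \<alpha>" using c(1) lincomb_cong[OF eq] by simp
  show "coef \<alpha> \<gamma> \<in> \<int>" if "\<gamma> \<in> Pi" for \<gamma> using c(2) eq that by simp
  show "(\<forall>\<gamma>\<in>Pi. coef \<alpha> \<gamma> \<ge> 0) \<or> (\<forall>\<gamma>\<in>Pi. coef \<alpha> \<gamma> \<le> 0)" using c(3) eq by simp
qed

lemma coef_zero: "\<gamma> \<in> Pi \<Longrightarrow> coef 0 \<gamma> = 0"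
  by (rule coef_eq[OF lincomb_zero[symmetric]])

lemma weight_coef: "\<alpha> \<in> weights \<Longrightarrow> lincomb (coef \<alpha>) Pi = \<alpha>"
  unfolding weights_def using root_coef(1) lincomb_cong[of Pi "coef 0" "\<lambda>_. 0"] coef_zero lincomb_zero by auto

lemma coef_add:
  assumes "\<alpha> \<in> weights" "\<beta> \<in> weights" "\<gamma> \<in> Pi"
  shows "coef (\<alpha> + \<beta>) \<gamma> = coef \<alpha> \<gamma> + coef \<beta> \<gamma>"
  using assms by (intro coef_eq[where c = "\<lambda>\<gamma>. coef \<alpha> \<gamma> + coef \<beta> \<gamma>"])
    (simp_all only: lincomb_add weight_coef)

lemma coef_uminus:
  assumes "\<alpha> \<in> weights" "\<gamma> \<in> Pi"
  shows "coef (- \<alpha>) \<gamma> = - coef \<alpha> \<gamma>"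
  using assms by (intro coef_eq[where c = "\<lambda>\<gamma>. - coef \<alpha> \<gamma>"])
    (simp_all only: lincomb_uminus weight_coef)

lemma pos_roots_iff: "\<beta> \<in> pos_roots h Pi \<longleftrightarrow> \<beta> \<in> roots h \<and> (\<forall>\<gamma>\<in>Pi. coef \<beta> \<gamma> \<ge> 0)"
proof
  assume "\<beta> \<in> pos_roots h Pi"
  then obtain c where c: "\<beta> \<in> roots h" "\<forall>\<gamma>\<in>Pi. c \<gamma> \<ge> 0" "\<beta> = lincomb c Pi"
    by (auto simp: pos_roots_def weight_le_def)
  thus "\<beta> \<in> roots h \<and> (\<forall>\<gamma>\<in>Pi. coef \<beta> \<gamma> \<ge> 0)" using coef_eq[OF c(3)] by simp
next
  assume b: "\<beta> \<in> roots h \<and> (\<forall>\<gamma>\<in>Pi. coef \<beta> \<gamma> \<ge> 0)"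
  hence "\<beta> - 0 = lincomb (coef \<beta>) Pi" using root_coef(1) by simp
  thus "\<beta> \<in> pos_roots h Pi" using b unfolding pos_roots_def weight_le_def by blast
qed

lemma root_pos_or_neg: "\<alpha> \<in> roots h \<Longrightarrow> \<alpha> \<in> pos_roots h Pi \<or> - \<alpha> \<in> pos_roots h Pi"
  using root_coef(3)[of \<alpha>] roots_uminus[of \<alpha>] coef_uminus[of \<alpha>] by (auto simp: pos_roots_iff weights_def)

definition level :: "('g \<Rightarrow> complex) set \<Rightarrow> ('g \<Rightarrow> complex) \<Rightarrow> real" where
  "level A \<alpha> = (\<Sum>\<gamma>\<in>A. coef \<alpha> \<gamma>)"

lemma level_add: "A \<subseteq> Pi \<Longrightarrow> \<alpha> \<in> weights \<Longrightarrow> \<beta> \<in> weights \<Longrightarrow> level A (\<alpha> + \<beta>) = level A \<alpha> + level A \<beta>"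
  unfolding level_def by (subst sum.distrib[symmetric], rule sum.cong) (auto intro: coef_add)

lemma level_uminus: "A \<subseteq> Pi \<Longrightarrow> \<alpha> \<in> weights \<Longrightarrow> level A (- \<alpha>) = - level A \<alpha>"
  unfolding level_def by (subst sum_negf[symmetric], rule sum.cong) (auto intro: coef_uminus)

lemma level_zero: "A \<subseteq> Pi \<Longrightarrow> level A 0 = 0"
  unfolding level_def by (intro sum.neutral) (auto intro: coef_zero)

lemma level_pos_root: "A \<subseteq> Pi \<Longrightarrow> \<beta> \<in> pos_roots h Pi \<Longrightarrow> level A \<beta> \<ge> 0"
  unfolding level_def by (intro sum_nonneg) (auto simp: pos_roots_iff)

lemma height_pos:
  assumes "\<beta> \<in> pos_roots h Pi"
  shows "level Pi \<beta> > 0"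
proof -
  have b: "\<beta> \<in> roots h" "\<forall>\<gamma>\<in>Pi. coef \<beta> \<gamma> \<ge> 0" using assms by (auto simp: pos_roots_iff)
  have "level Pi \<beta> \<noteq> 0"
  proof
    assume "level Pi \<beta> = 0"
    hence "\<forall>\<gamma>\<in>Pi. coef \<beta> \<gamma> = 0" using b finite_Pi by (simp add: level_def sum_nonneg_eq_0_iff)
    hence "\<beta> = 0" using root_coef(1)[OF b(1)] lincomb_cong[of Pi "coef \<beta>" "\<lambda>_. 0"] by (simp add: lincomb_zero)
    thus False using roots_nonzero b by blast
  qed
  thus ?thesis using level_pos_root[OF order_refl assms] by simp
qed

text \<open>
  The coefficients of a root have equal signs, so their sum over \<open>A\<close> vanishes only if each does.
\<close>

lemma level_zero_iff:
  assumes A: "A \<subseteq> Pi" and \<alpha>: "\<alpha> \<in> roots h"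
  shows "level A \<alpha> = 0 \<longleftrightarrow> \<alpha> \<in> generated_roots h (Pi - A)"
proof
  have finA: "finite A" using A finite_Pi finite_subset by blast
  assume l: "level A \<alpha> = 0"
  have "\<forall>\<gamma>\<in>A. coef \<alpha> \<gamma> = 0"
  proof (cases "\<forall>\<gamma>\<in>Pi. coef \<alpha> \<gamma> \<ge> 0")
    case True
    hence "\<And>\<gamma>. \<gamma> \<in> A \<Longrightarrow> 0 \<le> coef \<alpha> \<gamma>" using A by blast
    from sum_nonneg_eq_0_iff[OF finA this] show ?thesis using l by (simp add: level_def)
  next
    case False
    hence "\<And>\<gamma>. \<gamma> \<in> A \<Longrightarrow> coef \<alpha> \<gamma> \<le> 0" using root_coef(3)[OF \<alpha>] A by blast
    hence "\<And>\<gamma>. \<gamma> \<in> A \<Longrightarrow> 0 \<le> - coef \<alpha> \<gamma>" by simp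
    from sum_nonneg_eq_0_iff[OF finA this] show ?thesis using l by (simp add: level_def sum_negf)
  qed
  hence "lincomb (coef \<alpha>) Pi = lincomb (coef \<alpha>) (Pi - A)"
    by (intro lincomb_superset finite_Pi) auto
  thus "\<alpha> \<in> generated_roots h (Pi - A)"
    using \<alpha> root_coef(1)[OF \<alpha>] unfolding generated_roots_def by auto
next
  assume "\<alpha> \<in> generated_roots h (Pi - A)"
  then obtain c where c: "\<alpha> = lincomb c (Pi - A)" by (auto simp: generated_roots_def)
  let ?c = "\<lambda>\<gamma>. if \<gamma> \<in> A then 0 else c \<gamma>"
  have "lincomb ?c Pi = lincomb ?c (Pi - A)" by (intro lincomb_superset finite_Pi) auto
  also have "\<dots> = \<alpha>" unfolding c by (rule lincomb_cong) auto
  finally have "coef \<alpha> \<gamma> = ?c \<gamma>" if "\<gamma> \<in> Pi" for \<gamma>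
    using coef_eq[OF sym, of ?c \<alpha>] that by blast
  thus "level A \<alpha> = 0" using A unfolding level_def by (intro sum.neutral) auto
qed

lemma generated_roots_uminus: "\<alpha> \<in> generated_roots h B \<Longrightarrow> - \<alpha> \<in> generated_roots h B"
  unfolding generated_roots_def using roots_uminus lincomb_uminus[symmetric, of _ B] by blast

lemma roots_nonempty: "roots h \<noteq> {}"
proof
  assume "roots h = {}"
  hence "weight_span {0} = UNIV" using weight_span_weights by (simp add: weights_def)
  moreover have "weight_span {0} = h"
    unfolding weight_span_def using root_space_0 subspace_h by (simp add: complex_vec.span_eq_iff)
  ultimately show False using nonabelian h_comm by auto
qed

lemma weight_span_Un_decompose:
  assumes "x \<in> weight_span (A \<union> B)"
  shows "\<exists>a\<in>weight_span A. \<exists>b\<in>weight_span B. x = a + b"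
  using assms unfolding weight_span_def by (auto simp: UN_Un complex_vec.span_Un)

end

section \<open>The grading by level\<close>

locale graded_simple = simple_with_root_basis h Pi for h :: "'g::complex_lie_algebra set" and Pi +
  fixes A assumes A_sub: "A \<subseteq> Pi"
begin

text \<open>
  The predicate selects levels, so that single levels and half-lines are treated alike.
\<close>

definition level_space :: "(real \<Rightarrow> bool) \<Rightarrow> 'g set" where
  "level_space p = weight_span {\<alpha>\<in>weights. p (level A \<alpha>)}"

lemma subspace_level_space: "complex_vec.subspace (level_space p)" unfolding level_space_def by (rule subspace_weight_span)

lemma level_space_dual: "{\<alpha>\<in>weights. p (level A \<alpha>)} \<subseteq> dual_space h" using weights_dual by auto

lemma lie_level_space:
  assumes "x \<in> level_space p" "y \<in> level_space q" "\<And>i j. p i \<Longrightarrow> q j \<Longrightarrow> r (i + j)"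
  shows "lie x y \<in> level_space r"
  using assms(1,2) unfolding level_space_def
  by (rule lie_weight_span[OF _ _ level_space_dual level_space_dual]) (auto simp: level_add[OF A_sub] intro: assms(3))

lemma level_space_disjoint:
  assumes "x \<in> level_space p" "x \<in> level_space q" "\<And>i. p i \<Longrightarrow> \<not> q i"
  shows "x = 0"
  using assms(1,2) unfolding level_space_def
  by (rule weight_span_disjoint[OF _ _ level_space_dual level_space_dual]) (use assms(3) in blast)

lemma level_space_decompose:
  assumes "x \<in> level_space r" "\<And>i. r i \<Longrightarrow> p i \<or> q i"
  shows "\<exists>a\<in>level_space p. \<exists>b\<in>level_space q. x = a + b"
proof -
  have "weight_span {\<alpha>\<in>weights. r (level A \<alpha>)} \<subseteq> weight_span ({\<alpha>\<in>weights. p (level A \<alpha>)} \<union> {\<alpha>\<in>weights. q (level A \<alpha>)})"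
    using assms(2) by (intro weight_span_mono) auto
  thus ?thesis using assms(1) unfolding level_space_def by (intro weight_span_Un_decompose) blast
qed

text \<open>
  By the symmetry of the root system the lowest level is \<open>- top_level\<close>.
\<close>

definition "top_level = Max (level A ` roots h)"

lemma level_le_top: "\<alpha> \<in> roots h \<Longrightarrow> level A \<alpha> \<le> top_level"
  unfolding top_level_def using finite_roots by (intro Max_ge) auto

lemma top_level_attained: "\<exists>\<alpha>\<in>roots h. level A \<alpha> = top_level"
proof -
  have "top_level \<in> level A ` roots h" unfolding top_level_def using finite_roots roots_nonempty by (intro Max_in) auto
  thus ?thesis by auto
qed

lemma roots_weights: "\<alpha> \<in> roots h \<Longrightarrow> \<alpha> \<in> weights" by (simp add: weights_def)

lemma top_level_nonneg: "top_level \<ge> 0"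
proof -
  obtain \<alpha> where \<alpha>: "\<alpha> \<in> roots h" using roots_nonempty by blast
  have "level A (- \<alpha>) \<le> top_level" "level A \<alpha> \<le> top_level" using \<alpha> roots_uminus level_le_top by auto
  thus ?thesis using level_uminus[OF A_sub roots_weights[OF \<alpha>]] by linarith
qed

lemma level_ge: assumes "\<alpha> \<in> weights" shows "level A \<alpha> \<ge> - top_level"
proof (cases "\<alpha> = 0")
  case True
  thus ?thesis using top_level_nonneg level_zero[OF A_sub] by simp
next
  case False
  hence "\<alpha> \<in> roots h" using assms by (simp add: weights_def)
  thus ?thesis using level_le_top[OF roots_uminus] level_uminus[OF A_sub assms] by fastforce
qed

lemma level_space_UNIV: "level_space (\<lambda>i. i \<ge> - top_level) = UNIV"
proof -
  have "{\<alpha>\<in>weights. level A \<alpha> \<ge> - top_level} = weights" using level_ge by auto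
  thus ?thesis using weight_span_weights by (simp add: level_space_def)
qed

lemma level_space_below: assumes "x \<in> level_space (\<lambda>i. i < - top_level)" shows "x = 0"
proof -
  have eq: "{\<alpha>\<in>weights. level A \<alpha> < - top_level} = {}" using level_ge by force
  from assms show ?thesis unfolding level_space_def weight_span_def eq by simp
qed

text \<open>
  \<open>levi\<close> and \<open>nilrad\<close> are the Levi part and the nilradical of the parabolic subalgebra of
  nonnegative levels; if \<open>A\<close> is empty, then \<open>nilrad\<close> is zero and \<open>bottom\<close> is the whole algebra.
\<close>

abbreviation bottom :: "'g set" where "bottom \<equiv> level_space (\<lambda>i. i = - top_level)"
abbreviation nilrad :: "'g set" where "nilrad \<equiv> level_space (\<lambda>i. i > 0)"
abbreviation levi :: "'g set" where "levi \<equiv> level_space (\<lambda>i. i = 0)"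

text \<open>
  Negative levels kill \<open>T\<close>, and \<open>T + [nilrad, \<gg>]\<close> is stable under the nonnegative ones, so
  simplicity applies through \<open>generated_by_annihilated\<close>.
\<close>

lemma levi_stable_sum_nilrad:
  assumes T: "complex_vec.subspace T" "T \<subseteq> bottom" "t \<in> T" "t \<noteq> 0"
    and stable: "\<And>a t. a \<in> levi \<Longrightarrow> t \<in> T \<Longrightarrow> lie a t \<in> T"
  shows "\<exists>u\<in>T. \<exists>v\<in>bracket_span nilrad UNIV. x = u + v"
proof -
  let ?N = "bracket_span nilrad UNIV"
  let ?S = "{u + v | u v. u \<in> T \<and> v \<in> ?N}"
  have subN: "complex_vec.subspace ?N" by (rule subspace_bracket_span)
  have Nlevi: "lie a v \<in> ?N" if "a \<in> levi" "v \<in> ?N" for a v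
  proof -
    have "?N \<subseteq> {v. lie a v \<in> ?N}"
    proof (rule bracket_span_subset)
      show "complex_vec.subspace {v. lie a v \<in> ?N}" by (rule subspace_lie_vimage_right[OF subN])
      fix u w :: 'g assume u: "u \<in> nilrad"
      have "lie a u \<in> nilrad" using that(1) u by (rule lie_level_space) simp
      hence "lie (lie a u) w + lie u (lie a w) \<in> ?N"
        using u by (intro complex_vec.subspace_add[OF subN] lie_in_bracket_span) auto
      thus "lie u w \<in> {v. lie a v \<in> ?N}" using lie_leibniz[of a u w] by simp
    qed
    thus ?thesis using that by blast
  qed
  have "?S = UNIV"
  proof (rule generated_by_annihilated[of "level_space (\<lambda>i. i \<ge> 0)" T ?S])
    show "\<exists>a\<in>level_space (\<lambda>i. i \<ge> 0). \<exists>b. x = a + b \<and> (\<forall>t\<in>T. lie b t = 0)" for x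
    proof -
      have "x \<in> level_space (\<lambda>i. i \<ge> - top_level)" using level_space_UNIV by simp
      from level_space_decompose[OF this, of "\<lambda>i. i \<ge> 0" "\<lambda>i. i < 0"]
      obtain a b where ab: "a \<in> level_space (\<lambda>i. i \<ge> 0)" "b \<in> level_space (\<lambda>i. i < 0)" "x = a + b" by force
      have "lie b t = 0" if "t \<in> T" for t
      proof (rule level_space_below)
        show "lie b t \<in> level_space (\<lambda>i. i < - top_level)"
          by (rule lie_level_space[OF ab(2), of _ "\<lambda>i. i = - top_level"]) (use T that in auto)
      qed
      thus ?thesis using ab by blast
    qed
    show "complex_vec.subspace ?S" using T(1) subN by (rule complex_vec.subspace_sums)
    show "lie a s \<in> ?S" if as: "a \<in> level_space (\<lambda>i. i \<ge> 0)" "s \<in> ?S" for a s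
    proof -
      from level_space_decompose[OF as(1), of "\<lambda>i. i = 0" "\<lambda>i. i > 0"]
      obtain a0 a1 where a: "a0 \<in> levi" "a1 \<in> nilrad" "a = a0 + a1" by force
      obtain u v where s: "u \<in> T" "v \<in> ?N" "s = u + v" using as(2) by blast
      have "lie a0 v + lie a1 s \<in> ?N"
        using Nlevi a s by (intro complex_vec.subspace_add[OF subN]) (auto intro: lie_in_bracket_span)
      moreover have "lie a s = lie a0 u + (lie a0 v + lie a1 s)"
        using a s by (simp add: lie_add_left lie_add_right add.assoc)
      ultimately show ?thesis using stable[OF a(1) s(1)] by blast
    qed
    show "T \<subseteq> ?S" using complex_vec.subspace_0[OF subN] by force
  qed (use T in auto)
  hence "x \<in> ?S" by blast
  thus ?thesis by blast
qed

lemma bracket_nilrad_subset: "bracket_span nilrad UNIV \<subseteq> level_space (\<lambda>i. i > - top_level)"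
  using lie_level_space[of _ "\<lambda>i. i > 0" _ "\<lambda>i. i \<ge> - top_level" "\<lambda>i. i > - top_level"] level_space_UNIV
  by (intro bracket_span_subset subspace_level_space) auto

lemma bottom_root_space: "\<alpha> \<in> roots h \<Longrightarrow> level A \<alpha> = top_level \<Longrightarrow> root_space h (- \<alpha>) \<subseteq> bottom"
  unfolding level_space_def using roots_uminus[of \<alpha>] level_uminus[OF A_sub roots_weights[of \<alpha>]] roots_weights[of "- \<alpha>"]
  by (auto intro: weight_span_base)

lemma bottom_nonzero: "\<exists>t\<in>bottom. t \<noteq> 0"
  using top_level_attained bottom_root_space root_vector_exists[OF roots_uminus] by blast

text \<open>
  Brackets with \<open>nilrad\<close> stay above the lowest level, so \<open>T\<close> alone must fill \<open>bottom\<close>.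
\<close>

lemma bottom_irreducible:
  assumes T: "complex_vec.subspace T" "T \<subseteq> bottom" "t \<in> T" "t \<noteq> 0"
    and stable: "\<And>a t. a \<in> levi \<Longrightarrow> t \<in> T \<Longrightarrow> lie a t \<in> T"
  shows "T = bottom"
proof
  show "bottom \<subseteq> T"
  proof
    fix x assume x: "x \<in> bottom"
    obtain u v where uv: "u \<in> T" "v \<in> bracket_span nilrad UNIV" "x = u + v"
      using levi_stable_sum_nilrad[OF T stable] by blast
    hence "v = x - u" by simp
    hence "v \<in> bottom" using x uv(1) T(2) complex_vec.subspace_diff[OF subspace_level_space] by blast
    moreover have "v \<in> level_space (\<lambda>i. i > - top_level)" using uv(2) bracket_nilrad_subset by blast
    ultimately have "v = 0" by (rule level_space_disjoint) auto
    thus "x \<in> T" using uv by simp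
  qed
qed (rule T)

lemma levi_bottom: "a \<in> levi \<Longrightarrow> t \<in> bottom \<Longrightarrow> lie a t \<in> bottom"
  by (rule lie_level_space[of a "\<lambda>i. i = 0" t "\<lambda>i. i = - top_level"]) auto

lemma bottom_sum_nilrad: "\<exists>u\<in>bottom. \<exists>v\<in>bracket_span nilrad UNIV. x = u + v"
  using bottom_nonzero levi_stable_sum_nilrad[OF subspace_level_space order_refl] levi_bottom by blast

lemma bracket_nilrad: "bracket_span nilrad UNIV = level_space (\<lambda>i. i > - top_level)"
proof
  show "level_space (\<lambda>i. i > - top_level) \<subseteq> bracket_span nilrad UNIV"
  proof
    fix x assume x: "x \<in> level_space (\<lambda>i. i > - top_level)"
    obtain u v where uv: "u \<in> bottom" "v \<in> bracket_span nilrad UNIV" "x = u + v"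
      using bottom_sum_nilrad by blast
    hence "u = x - v" by simp
    hence "u \<in> level_space (\<lambda>i. i > - top_level)"
      using x uv(2) bracket_nilrad_subset complex_vec.subspace_diff[OF subspace_level_space] by blast
    hence "u = 0" using uv(1) by (rule level_space_disjoint) auto
    thus "x \<in> bracket_span nilrad UNIV" using uv by simp
  qed
qed (rule bracket_nilrad_subset)

text \<open>
  Levels above the lowest one are already in \<open>[nilrad, \<gg>]\<close>, so \<open>I\<close> contributes only through
  \<open>[I, bottom]\<close>; this is stable under \<open>levi\<close>, hence zero or \<open>bottom\<close>.
\<close>

lemma ideal_bracket_dichotomy:
  assumes I: "lie_ideal I levi" and m: "nilrad \<subseteq> m"
  shows "bracket_span I bottom = {0} \<Longrightarrow> bracket_span (complex_vec.span (m \<union> I)) UNIV = bracket_span m UNIV"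
    and "bracket_span I bottom \<noteq> {0} \<Longrightarrow> bracket_span (complex_vec.span (m \<union> I)) UNIV = UNIV"
proof -
  have Isub: "I \<subseteq> levi" and Iid: "\<And>a s. a \<in> levi \<Longrightarrow> s \<in> I \<Longrightarrow> lie a s \<in> I"
    using I by (auto simp: lie_ideal_def)
  have N: "bracket_span nilrad UNIV \<subseteq> bracket_span m UNIV" using m by (intro bracket_span_mono) auto
  {
    assume z: "bracket_span I bottom = {0}"
    have "bracket_span (m \<union> I) UNIV \<subseteq> bracket_span m UNIV"
    proof (rule bracket_span_subset[OF subspace_bracket_span])
      fix u w :: 'g assume u: "u \<in> m \<union> I"
      show "lie u w \<in> bracket_span m UNIV"
      proof (cases "u \<in> m")
        case True thus ?thesis by (intro lie_in_bracket_span) auto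
      next
        case False
        hence uI: "u \<in> I" using u by blast
        obtain a b where ab: "a \<in> bottom" "b \<in> bracket_span nilrad UNIV" "w = a + b"
          using bottom_sum_nilrad by blast
        have "lie u a = 0" using z lie_in_bracket_span[OF uI ab(1)] by blast
        hence "lie u w = lie u b" using ab by (simp add: lie_add_right)
        moreover have "lie u b \<in> level_space (\<lambda>i. i > - top_level)"
          by (rule lie_level_space[of u "\<lambda>i. i = 0" b "\<lambda>i. i > - top_level"]) (use uI Isub ab bracket_nilrad in auto)
        ultimately show ?thesis using N bracket_nilrad by auto
      qed
    qed
    moreover have "bracket_span m UNIV \<subseteq> bracket_span (m \<union> I) UNIV" by (intro bracket_span_mono) auto
    ultimately show "bracket_span (complex_vec.span (m \<union> I)) UNIV = bracket_span m UNIV"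
      by (simp add: bracket_span_span)
  }
  {
    let ?T = "bracket_span I bottom"
    assume nz: "?T \<noteq> {0}"
    then obtain t where t: "t \<in> ?T" "t \<noteq> 0"
      using complex_vec.subspace_0[OF subspace_bracket_span, of I bottom] by blast
    have sub: "?T \<subseteq> bottom"
      by (rule bracket_span_subset[OF subspace_level_space]) (use Isub levi_bottom in blast)
    have "lie a t \<in> ?T" if "a \<in> levi" "t \<in> ?T" for a t
    proof -
      have "?T \<subseteq> {v. lie a v \<in> ?T}"
      proof (rule bracket_span_subset)
        show "complex_vec.subspace {v. lie a v \<in> ?T}" by (rule subspace_lie_vimage_right[OF subspace_bracket_span])
        fix u w assume u: "u \<in> I" "w \<in> bottom"
        hence "lie (lie a u) w + lie u (lie a w) \<in> ?T"
          using that(1) Iid levi_bottom by (intro complex_vec.subspace_add[OF subspace_bracket_span] lie_in_bracket_span) auto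
        thus "lie u w \<in> {v. lie a v \<in> ?T}" using lie_leibniz[of a u w] by simp
      qed
      thus ?thesis using that by blast
    qed
    from bottom_irreducible[OF subspace_bracket_span sub t this] have T: "?T = bottom" by simp
    have "?T \<subseteq> bracket_span (m \<union> I) UNIV" by (intro bracket_span_mono) auto
    hence 1: "bottom \<subseteq> bracket_span (m \<union> I) UNIV" by (simp only: T)
    have 2: "bracket_span nilrad UNIV \<subseteq> bracket_span (m \<union> I) UNIV"
      using m by (intro bracket_span_mono) auto
    have "x \<in> bracket_span (m \<union> I) UNIV" for x
    proof -
      obtain u v where uv: "u \<in> bottom" "v \<in> bracket_span nilrad UNIV" "x = u + v"
        using bottom_sum_nilrad by blast
      thus ?thesis using 1 2 complex_vec.subspace_add[OF subspace_bracket_span] by blast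
    qed
    thus "bracket_span (complex_vec.span (m \<union> I)) UNIV = UNIV" by (auto simp: bracket_span_span)
  }
qed

text \<open>
  The vectors of \<open>bottom\<close> killed by an ideal of \<open>levi\<close> form a \<open>levi\<close>-stable subspace, and
  irreducibility leaves only the whole of \<open>bottom\<close>.
\<close>

lemma ideal_kills_bottom:
  assumes I: "lie_ideal I levi" and x: "x \<in> bottom" "x \<noteq> 0" "\<And>s. s \<in> I \<Longrightarrow> lie s x = 0"
  shows "bracket_span I bottom = {0}"
proof -
  have Iid: "\<And>a s. a \<in> levi \<Longrightarrow> s \<in> I \<Longrightarrow> lie a s \<in> I"
    using I by (auto simp: lie_ideal_def)
  let ?T = "{x\<in>bottom. \<forall>s\<in>I. lie s x = 0}"
  have "?T = bottom"
  proof (rule bottom_irreducible)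
    show "complex_vec.subspace ?T"
      using subspace_level_space[of "\<lambda>i. i = - top_level"] by (auto simp: complex_vec.subspace_def lie_add_right lie_scaleC_right)
    show "lie a t \<in> ?T" if "a \<in> levi" "t \<in> ?T" for a t
    proof -
      have "lie s (lie a t) = 0" if s: "s \<in> I" for s
      proof -
        have "lie s a = - lie a s" by (rule lie_anticomm)
        moreover have "lie (lie a s) t = 0" "lie s t = 0" using Iid s \<open>a \<in> levi\<close> \<open>t \<in> ?T\<close> by auto
        ultimately show ?thesis using lie_leibniz[of s a t] by simp
      qed
      thus ?thesis using that levi_bottom by auto
    qed
  qed (use x in auto)
  hence "bracket_span I bottom \<subseteq> {0}"
    by (intro bracket_span_subset) (auto simp: complex_vec.subspace_single_0)
  thus ?thesis using complex_vec.subspace_0[OF subspace_bracket_span] by blast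
qed

end

section \<open>Standard subalgebras with nilpotent radical\<close>

theorem theorem2p2:
  fixes h m r0 \<tau> :: "'g::complex_lie_algebra set"
    and Pi R Psi :: "('g \<Rightarrow> complex) set"
    and C :: "('g \<Rightarrow> complex) set set"
    and e :: "('g \<Rightarrow> complex) \<Rightarrow> 'g"
  assumes fin_dim: "\<exists>B. finite B \<and> complex_vec.span B = (UNIV :: 'g set)"
    and simple: "lie_simple (UNIV :: 'g set)"
    and cartan: "cartan_subalgebra h"
    and basis: "root_basis h Pi"
    and root_vectors: "\<forall>\<alpha>\<in>roots h. e \<alpha> \<in> root_space h \<alpha> \<and> e \<alpha> \<noteq> 0"
    and R_pos: "R \<subseteq> pos_roots h Pi"
    and R_noncomparable: "pairwise (\<lambda>\<omega>\<^sub>1 \<omega>\<^sub>2. \<not> weight_le Pi \<omega>\<^sub>1 \<omega>\<^sub>2) R"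
    and m: "m = nilp_standard h Pi R"
    and components:
      "C \<subseteq> dynkin_components h (Pi - S1 Pi R) \<inter> dynkin_components h (Pi - S2 h Pi R)"
    and Psi: "Psi = \<Union>C"
    and r0: "r0 = r_Psi h e Psi"
    and r0_ideal: "lie_ideal r0 (r1 h Pi R)"
    and r0_sub: "r0 \<subseteq> r2 h Pi R"
    and tau: "\<tau> = complex_vec.span (m \<union> r0)"
    and standard: "standard_subalgebra \<tau>"
    and nilpotent_radical: "lie_nilpotent (lie_radical \<tau>)"
    and semisimple_part: "levi_factor r0 \<tau>"
  shows "(P_minus h Pi R Psi = {0} \<longrightarrow> bracket_span \<tau> UNIV = bracket_span m UNIV) \<and>
         (P_minus h Pi R Psi \<noteq> {0} \<longrightarrow> bracket_span \<tau> UNIV = UNIV)"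
proof -
  interpret graded_simple h Pi "S1 Pi R"
    by unfold_locales (use fin_dim simple cartan basis in \<open>auto simp: S1_def\<close>)
  have r1_levi: "r1 h Pi R = levi"
  proof -
    have eq: "insert 0 (generated_roots h (Pi - S1 Pi R)) = {\<alpha>\<in>weights. level (S1 Pi R) \<alpha> = 0}"
      using level_zero_iff[OF A_sub] level_zero[OF A_sub] by (auto simp: weights_def generated_roots_def)
    have "h \<union> (\<Union>\<alpha>\<in>generated_roots h (Pi - S1 Pi R). root_space h \<alpha>)
        = (\<Union>\<alpha>\<in>insert 0 (generated_roots h (Pi - S1 Pi R)). root_space h \<alpha>)"
      using root_space_0 by auto
    thus ?thesis unfolding r1_def reductive_part_def level_space_def weight_span_def eq by simp
  qed
  have ideal: "lie_ideal r0 levi" using r0_ideal r1_levi by simp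
  have pos_R1: "\<alpha> \<in> R1 h Pi R" if \<alpha>: "\<alpha> \<in> roots h" "level (S1 Pi R) \<alpha> > 0" for \<alpha>
  proof -
    have "\<exists>\<gamma>\<in>S1 Pi R. coef \<alpha> \<gamma> > 0"
    proof (rule ccontr)
      assume "\<not> ?thesis"
      hence "level (S1 Pi R) \<alpha> \<le> 0" unfolding level_def by (intro sum_nonpos) force
      thus False using \<alpha> by simp
    qed
    then obtain \<gamma> where \<gamma>: "\<gamma> \<in> R" "\<gamma> \<in> Pi" "coef \<alpha> \<gamma> > 0" by (auto simp: S1_def)
    have nonneg: "\<forall>\<delta>\<in>Pi. coef \<alpha> \<delta> \<ge> 0" using root_coef(3)[OF \<alpha>(1)] \<gamma> by fastforce
    \<comment> \<open>Integrality is what makes \<open>\<alpha> - \<gamma>\<close> a nonnegative combination.\<close>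
    have ge1: "coef \<alpha> \<gamma> \<ge> 1" using root_coef(2)[OF \<alpha>(1) \<gamma>(2)] \<gamma>(3) by (auto elim!: Ints_cases)
    let ?c = "\<lambda>\<delta>. coef \<alpha> \<delta> + - (if \<delta> = \<gamma> then 1 else 0)"
    have "\<alpha> - \<gamma> = lincomb ?c Pi"
      unfolding lincomb_add lincomb_uminus lincomb_single[OF finite_Pi \<gamma>(2)] root_coef(1)[OF \<alpha>(1)] by simp
    moreover have "\<forall>\<delta>\<in>Pi. ?c \<delta> \<ge> 0" using nonneg ge1 by auto
    ultimately have "weight_le Pi \<gamma> \<alpha>" unfolding weight_le_def by (intro exI[of _ ?c] conjI)
    thus ?thesis using \<alpha> nonneg \<gamma> by (auto simp: R1_def pos_roots_iff)
  qed
  have "nilrad \<subseteq> m"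
    unfolding level_space_def m nilp_standard_def weight_span_def[symmetric]
    by (rule weight_span_mono) (use pos_R1 level_zero[OF A_sub] in \<open>auto simp: weights_def\<close>)
  note dich = ideal_bracket_dichotomy[OF ideal this, folded tau]
  have P0: "lie x y = 0" if "P_minus h Pi R Psi = {0}" "\<alpha> \<in> generated_roots h Psi"
    "x \<in> root_space h \<alpha>" "y \<in> n2_minus h Pi R" for x y \<alpha>
  proof -
    have "lie x y \<in> bracket_span (root_space h \<alpha>) (n2_minus h Pi R)" using that by (intro lie_in_bracket_span)
    hence "lie x y \<in> P_minus h Pi R Psi"
      unfolding P_minus_def using that(2) by (intro complex_vec.span_base) blast
    thus ?thesis using that by blast
  qed
  have "bracket_span r0 bottom = {0}" if P: "P_minus h Pi R Psi = {0}"
  proof -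
    \<comment> \<open>A root of greatest height in \<open>?B\<close> is outside \<open>R2\<close>: adding a positive root would stay in
      \<open>?B\<close> and raise the height.\<close>
    let ?B = "{\<beta>\<in>pos_roots h Pi. level (S1 Pi R) \<beta> = top_level}"
    have finB: "finite ?B" using finite_roots by (auto simp: pos_roots_def intro: finite_subset)
    have "?B \<noteq> {}"
    proof -
      obtain \<alpha> where \<alpha>: "\<alpha> \<in> roots h" "level (S1 Pi R) \<alpha> = top_level" using top_level_attained by blast
      show ?thesis
      proof (cases "\<alpha> \<in> pos_roots h Pi")
        case False
        hence neg: "- \<alpha> \<in> pos_roots h Pi" using root_pos_or_neg \<alpha> by blast
        hence "level (S1 Pi R) (- \<alpha>) \<ge> 0" by (rule level_pos_root[OF A_sub])
        hence "level (S1 Pi R) (- \<alpha>) = top_level"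
          using \<alpha> top_level_nonneg level_uminus[OF A_sub roots_weights[OF \<alpha>(1)]] by linarith
        thus ?thesis using neg by blast
      qed (use \<alpha> in blast)
    qed
    hence "Max (level Pi ` ?B) \<in> level Pi ` ?B" using finB by (intro Max_in) auto
    then obtain \<beta> where \<beta>: "\<beta> \<in> ?B" "Max (level Pi ` ?B) = level Pi \<beta>" by blast
    have max: "level Pi \<delta> \<le> level Pi \<beta>" if "\<delta> \<in> ?B" for \<delta>
      using that finB \<beta>(2)[symmetric] by simp
    have \<beta>r: "\<beta> \<in> roots h" using \<beta>(1) by (simp add: pos_roots_iff)
    have "\<beta> \<notin> R2 h Pi R"
    proof
      assume "\<beta> \<in> R2 h Pi R"
      then obtain \<delta> where \<delta>: "\<delta> \<in> pos_roots h Pi" "\<beta> + \<delta> \<in> roots h" by (auto simp: R2_def R1_def)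
      have w: "\<beta> \<in> weights" "\<delta> \<in> weights" using \<beta>r \<delta> by (auto simp: weights_def pos_roots_iff)
      have "\<beta> + \<delta> \<in> pos_roots h Pi"
        using \<beta>(1) \<delta> w by (auto simp: pos_roots_iff coef_add)
      moreover have "level (S1 Pi R) (\<beta> + \<delta>) = top_level"
        using level_add[OF A_sub w] level_pos_root[OF A_sub \<delta>(1)] level_le_top[OF \<delta>(2)] \<beta>(1) by force
      ultimately have "level Pi (\<beta> + \<delta>) \<le> level Pi \<beta>" by (intro max) simp
      thus False using level_add[OF order_refl w] height_pos[OF \<delta>(1)] by simp
    qed
    obtain x where x: "x \<in> root_space h (- \<beta>)" "x \<noteq> 0" using root_vector_exists[OF roots_uminus[OF \<beta>r]] by blast
    have xn: "x \<in> n2_minus h Pi R"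
      unfolding n2_minus_def using x \<beta>(1) \<open>\<beta> \<notin> R2 h Pi R\<close> by (intro complex_vec.span_base) blast
    have xb: "x \<in> bottom" using bottom_root_space[OF \<beta>r] x \<beta>(1) by blast
    have "lie s x = 0" if "s \<in> r0" for s
    proof -
      have "r_Psi h e Psi \<subseteq> {s. lie s x \<in> {0}}"
        unfolding r_Psi_def
      proof (rule complex_vec.span_minimal)
        show "complex_vec.subspace {s. lie s x \<in> {0}}"
          by (rule subspace_lie_vimage_left) (simp add: complex_vec.subspace_single_0)
        have "lie (lie (e \<alpha>) (e (- \<alpha>))) x = 0" if \<alpha>: "\<alpha> \<in> generated_roots h Psi" for \<alpha>
        proof -
          have "\<alpha> \<in> roots h" "- \<alpha> \<in> roots h" using \<alpha> generated_roots_uminus[OF \<alpha>] by (auto simp: generated_roots_def)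
          hence "lie (e \<alpha>) x = 0" "lie (e (- \<alpha>)) x = 0"
            using P0[OF P \<alpha> _ xn] P0[OF P generated_roots_uminus[OF \<alpha>] _ xn] root_vectors by auto
          thus ?thesis using lie_leibniz[of "e \<alpha>" "e (- \<alpha>)" x] by simp
        qed
        thus "(\<Union>\<alpha>\<in>generated_roots h Psi. root_space h \<alpha>) \<union>
            {lie (e \<alpha>) (e (- \<alpha>)) |\<alpha>. \<alpha> \<in> generated_roots h Psi} \<subseteq> {s. lie s x \<in> {0}}"
          using P0[OF P _ _ xn] by auto
      qed
      thus ?thesis using that r0 by blast
    qed
    thus ?thesis by (intro ideal_kills_bottom[OF ideal xb x(2)])
  qed
  moreover have "P_minus h Pi R Psi = {0}" if z: "bracket_span r0 bottom = {0}"
  proof -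
    have "n2_minus h Pi R \<subseteq> bottom"
      unfolding n2_minus_def
    proof (rule complex_vec.span_minimal[OF _ subspace_level_space], rule subsetI)
      fix x assume "x \<in> (\<Union>\<beta>\<in>pos_roots h Pi - R2 h Pi R. root_space h (- \<beta>))"
      then obtain \<beta> where \<beta>: "\<beta> \<in> pos_roots h Pi" "\<beta> \<notin> R2 h Pi R" "x \<in> root_space h (- \<beta>)" by blast
      hence \<beta>r: "\<beta> \<in> roots h" by (simp add: pos_roots_iff)
      show "x \<in> bottom"
      proof (cases "level (S1 Pi R) \<beta> = top_level")
        case True
        thus ?thesis using bottom_root_space[OF \<beta>r] \<beta>(3) by blast
      next
        case False
        hence lt: "level (S1 Pi R) \<beta> < top_level" using level_le_top[OF \<beta>r] by simp
        have mw: "- \<beta> \<in> weights" using roots_uminus[OF \<beta>r] roots_weights by blast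
        have "x \<in> level_space (\<lambda>i. i > - top_level)"
          unfolding level_space_def using lt mw \<beta>(3) level_uminus[OF A_sub roots_weights[OF \<beta>r]]
          by (intro weight_span_base) auto
        hence "x \<in> bracket_span nilrad UNIV" using bracket_nilrad by simp
        \<comment> \<open>A bracket of weight \<open>- \<beta>\<close> comes from weights \<open>\<delta>\<close> of positive level and \<open>- (\<beta> + \<delta>)\<close>, which
          would put \<open>\<beta>\<close> into \<open>R2\<close>.\<close>
        moreover have "bracket_span nilrad UNIV \<subseteq> weight_span (weights - {- \<beta>})"
        proof (rule bracket_span_subset[OF subspace_weight_span])
          fix u w :: 'g assume u: "u \<in> nilrad"
          show "lie u w \<in> weight_span (weights - {- \<beta>})"
          proof (rule lie_weight_span[OF u[unfolded level_space_def] _ level_space_dual])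
            show "w \<in> weight_span weights" using weight_span_weights by simp
            show "weights \<subseteq> dual_space h" using weights_dual by blast
            fix \<delta> \<epsilon> assume \<delta>: "\<delta> \<in> {\<alpha> \<in> weights. 0 < level (S1 Pi R) \<alpha>}" and \<epsilon>: "\<epsilon> \<in> weights"
              and sum: "\<delta> + \<epsilon> \<in> weights"
            have \<delta>r: "\<delta> \<in> roots h" using \<delta> level_zero[OF A_sub] by (auto simp: weights_def)
            have "\<delta> + \<epsilon> \<noteq> - \<beta>"
            proof
              assume eq: "\<delta> + \<epsilon> = - \<beta>"
              hence \<epsilon>eq: "- \<epsilon> = \<beta> + \<delta>" by (simp add: algebra_simps eq_neg_iff_add_eq_0 neg_eq_iff_add_eq_0)
              have "level (S1 Pi R) (\<beta> + \<delta>) > 0"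
                using \<delta> level_add[OF A_sub roots_weights[OF \<beta>r] roots_weights[OF \<delta>r]]
                  level_pos_root[OF A_sub \<beta>(1)] by simp
              hence "\<epsilon> \<noteq> 0" using \<epsilon>eq level_zero[OF A_sub] by force
              hence "\<beta> + \<delta> \<in> roots h" using \<epsilon> roots_uminus[of \<epsilon>] \<epsilon>eq by (auto simp: weights_def)
              hence "\<beta> \<in> R2 h Pi R" using \<beta>(1) pos_R1[OF \<delta>r] \<delta> by (auto simp: R2_def)
              thus False using \<beta>(2) by blast
            qed
            thus "\<delta> + \<epsilon> \<in> weights - {- \<beta>}" using sum by blast
          qed
        qed
        moreover have "x \<in> weight_span {- \<beta>}" using \<beta>(3) by (intro weight_span_base) auto
        ultimately have "x = 0" using weights_dual mw by (intro weight_span_disjoint[of x "weights - {- \<beta>}" "{- \<beta>}"]) auto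
        thus ?thesis using complex_vec.subspace_0[OF subspace_level_space] by simp
      qed
    qed
    moreover have "root_space h \<alpha> \<subseteq> r0" if "\<alpha> \<in> generated_roots h Psi" for \<alpha>
      unfolding r0 r_Psi_def using that by (intro subsetI complex_vec.span_base) blast
    ultimately have "bracket_span (root_space h \<alpha>) (n2_minus h Pi R) \<subseteq> {0}" if "\<alpha> \<in> generated_roots h Psi" for \<alpha>
      using z bracket_span_mono that by metis
    hence "P_minus h Pi R Psi \<subseteq> {0}"
      unfolding P_minus_def by (intro complex_vec.span_minimal) (auto simp: complex_vec.subspace_single_0)
    thus ?thesis unfolding P_minus_def using complex_vec.span_zero by blast
  qed
  ultimately show ?thesis using dich by blast
qed

end
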